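(* The functors $P_\tau:\mathcal{T}ych\to\mathcal{T}ych$ and $\hat P:\mathcal{T}ych\to\mathcal{T}ych$ can be lifted to the category $\mathcal{U}nif$ of uniform spaces and their uniformly continuous maps; that is, for each $F\in\{P_\tau,\hat P\}$ there exists a functor $\tilde F:\mathcal{U}nif\to\mathcal{U}nif$ such that $U\circ\tilde F=F\circ U$, where $U:\mathcal{U}nif\to\mathcal{T}ych$ is the forgetful functor.
   Context: $\mathcal{T}ych$ is the category of Tychonoff spaces and continuous maps; uniform spaces are Hausdorff, and $U$ sends a uniform space $(X,\mathcal U)$ to $X$ with the topology generated by $\mathcal U$ and is the identity on maps. For a Tychonoff space $X$, $P_\tau(X)$ is the set of all $\tau$-smooth probability measures on $X$, i.e. regular Borel probability measures $\mu$ such that $\lim_\alpha\mu(F_\alpha)=0$ for every decreasing net $(F_\alpha)$ of closed subsets of $X$ with empty intersection, endowed with the weakest topology making all maps $\mu\mapsto\int_X f\,d\mu$, $f:X\to\mathbb R$ bounded continuous, continuous. $\hat P(X)\subset P_\tau(X)$ is the subspace of Radon probability measures (those with $\mu(B)=\sup\{\mu(K):K\subset B \text{ compact}\}$ for all Borel $B\subset X$). For a continuous map $f:X\to Y$, $P_\tau(f)$ and $\hat P(f)$ are the push-forward of measures. *)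

theory Defs
  imports "HOL-Probability.Probability"
begin

section \<open>Categories and functors\<close>

text \<open>A category is given by its objects, its hom-sets, its identities and its composition;
  \<open>Comp \<C> X Y Z g f\<close> is the composite of \<open>f : X \<rightarrow> Y\<close> and \<open>g : Y \<rightarrow> Z\<close>.\<close>

record ('o, 'm) cat =
  Obj :: "'o set"
  Hom :: "'o \<Rightarrow> 'o \<Rightarrow> 'm set"
  Ident :: "'o \<Rightarrow> 'm"
  Comp :: "'o \<Rightarrow> 'o \<Rightarrow> 'o \<Rightarrow> 'm \<Rightarrow> 'm \<Rightarrow> 'm"

definition is_category :: "('o, 'm) cat \<Rightarrow> bool" where
  "is_category \<C> \<longleftrightarrow>
     (\<forall>X\<in>Obj \<C>. Ident \<C> X \<in> Hom \<C> X X) \<and>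
     (\<forall>X\<in>Obj \<C>. \<forall>Y\<in>Obj \<C>. \<forall>Z\<in>Obj \<C>. \<forall>f\<in>Hom \<C> X Y. \<forall>g\<in>Hom \<C> Y Z.
        Comp \<C> X Y Z g f \<in> Hom \<C> X Z) \<and>
     (\<forall>X\<in>Obj \<C>. \<forall>Y\<in>Obj \<C>. \<forall>f\<in>Hom \<C> X Y.
        Comp \<C> X X Y f (Ident \<C> X) = f \<and> Comp \<C> X Y Y (Ident \<C> Y) f = f) \<and>
     (\<forall>W\<in>Obj \<C>. \<forall>X\<in>Obj \<C>. \<forall>Y\<in>Obj \<C>. \<forall>Z\<in>Obj \<C>.
        \<forall>f\<in>Hom \<C> W X. \<forall>g\<in>Hom \<C> X Y. \<forall>h\<in>Hom \<C> Y Z.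
          Comp \<C> W X Z (Comp \<C> X Y Z h g) f = Comp \<C> W Y Z h (Comp \<C> W X Y g f))"

record ('o, 'm, 'p, 'n) fctr =
  on_obj :: "'o \<Rightarrow> 'p"
  on_hom :: "'o \<Rightarrow> 'o \<Rightarrow> 'm \<Rightarrow> 'n"

definition is_functor :: "('o, 'm) cat \<Rightarrow> ('p, 'n) cat \<Rightarrow> ('o, 'm, 'p, 'n) fctr \<Rightarrow> bool" where
  "is_functor \<C> \<D> F \<longleftrightarrow>
     (\<forall>X\<in>Obj \<C>. on_obj F X \<in> Obj \<D>) \<and>
     (\<forall>X\<in>Obj \<C>. \<forall>Y\<in>Obj \<C>. \<forall>f\<in>Hom \<C> X Y.
        on_hom F X Y f \<in> Hom \<D> (on_obj F X) (on_obj F Y)) \<and>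
     (\<forall>X\<in>Obj \<C>. on_hom F X X (Ident \<C> X) = Ident \<D> (on_obj F X)) \<and>
     (\<forall>X\<in>Obj \<C>. \<forall>Y\<in>Obj \<C>. \<forall>Z\<in>Obj \<C>. \<forall>f\<in>Hom \<C> X Y. \<forall>g\<in>Hom \<C> Y Z.
        on_hom F X Z (Comp \<C> X Y Z g f) =
          Comp \<D> (on_obj F X) (on_obj F Y) (on_obj F Z) (on_hom F Y Z g) (on_hom F X Y f))"

definition fcomp :: "('p, 'n, 'q, 'r) fctr \<Rightarrow> ('o, 'm, 'p, 'n) fctr \<Rightarrow> ('o, 'm, 'q, 'r) fctr"
    (infixr "\<circ>\<^sub>F" 55) where
  "G \<circ>\<^sub>F F = \<lparr> on_obj = (\<lambda>X. on_obj G (on_obj F X)),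
             on_hom = (\<lambda>X Y f. on_hom G (on_obj F X) (on_obj F Y) (on_hom F X Y f)) \<rparr>"

text \<open>Equality of functors with source \<open>\<C>\<close>. The values of the two records outside \<open>\<C>\<close> are junk,
  so HOL equality would be too strong.\<close>

definition functors_eq :: "('o, 'm) cat \<Rightarrow> ('o, 'm, 'p, 'n) fctr \<Rightarrow> ('o, 'm, 'p, 'n) fctr \<Rightarrow> bool" where
  "functors_eq \<C> F G \<longleftrightarrow>
     (\<forall>X\<in>Obj \<C>. on_obj F X = on_obj G X) \<and>
     (\<forall>X\<in>Obj \<C>. \<forall>Y\<in>Obj \<C>. \<forall>f\<in>Hom \<C> X Y. on_hom F X Y f = on_hom G X Y f)"


section \<open>Tychonoff spaces\<close>

text \<open>Maps between spaces are made \<^const>\<open>extensional\<close> on the underlying set of the source, so that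
  two morphisms are equal as soon as they agree on the points of the space.\<close>

definition Tychonoff_space :: "'a topology \<Rightarrow> bool" where
  "Tychonoff_space X \<longleftrightarrow> completely_regular_space X \<and> Hausdorff_space X"

definition Tych :: "('a topology, 'a \<Rightarrow> 'a) cat" where
  "Tych = \<lparr> Obj = {X. Tychonoff_space X},
            Hom = (\<lambda>X Y. {f \<in> extensional (topspace X). continuous_map X Y f}),
            Ident = (\<lambda>X. \<lambda>x\<in>topspace X. x),
            Comp = (\<lambda>X Y Z g f. compose (topspace X) g f) \<rparr>"

lemma is_category_Tych: "is_category Tych"
proof -
  have funcset: "f \<in> topspace X \<rightarrow> topspace Y" if "continuous_map X Y f" for X Y :: "'a topology" and f
    using that by (auto simp: continuous_map_def)
  have comp: "continuous_map X Z (compose (topspace X) g f)"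
    if "continuous_map X Y f" "continuous_map Y Z g" for X Y Z :: "'a topology" and f g
    using continuous_map_compose[OF that] by (rule continuous_map_eq) (simp add: compose_def)
  have ident: "continuous_map X X (\<lambda>x\<in>topspace X. x)" for X :: "'a topology"
    using continuous_map_id by (rule continuous_map_eq) simp
  show ?thesis
    unfolding is_category_def Tych_def cat.select_convs mem_Collect_eq
    by (intro conjI ballI; (elim CollectE conjE)?;
        (assumption | rule conjI comp ident Id_compose compose_Id compose_assoc[symmetric]
          compose_extensional restrict_extensional funcset)+)
qed


section \<open>Uniform spaces\<close>

text \<open>A uniformity on the set \<open>points S\<close> is a filter of entourages, as in the class
  \<^class>\<open>uniform_space\<close>; here it lives on the subset \<open>points S \<times> points S\<close> of the
  ambient type. The conditions are those of that class, together with the Hausdorff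
  separation axiom.\<close>

record 'a uspace =
  points :: "'a set"
  entourages :: "('a \<times> 'a) filter"

definition Hausdorff_uniform_space :: "'a uspace \<Rightarrow> bool" where
  "Hausdorff_uniform_space S \<longleftrightarrow>
     entourages S \<le> principal (points S \<times> points S) \<and>
     (\<forall>E. eventually E (entourages S) \<longrightarrow> (\<forall>x\<in>points S. E (x, x))) \<and>
     (\<forall>E. eventually E (entourages S) \<longrightarrow> eventually (\<lambda>(x, y). E (y, x)) (entourages S)) \<and>
     (\<forall>E. eventually E (entourages S) \<longrightarrow>
        (\<exists>D. eventually D (entourages S) \<and> (\<forall>x y z. D (x, y) \<longrightarrow> D (y, z) \<longrightarrow> E (x, z)))) \<and>
     (\<forall>x\<in>points S. \<forall>y\<in>points S. x \<noteq> y \<longrightarrow> (\<exists>E. eventually E (entourages S) \<and> \<not> E (x, y)))"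

definition uniformly_continuous_map :: "'a uspace \<Rightarrow> 'b uspace \<Rightarrow> ('a \<Rightarrow> 'b) \<Rightarrow> bool" where
  "uniformly_continuous_map S T f \<longleftrightarrow>
     f \<in> points S \<rightarrow> points T \<and>
     filterlim (\<lambda>(x, y). (f x, f y)) (entourages T) (entourages S)"

definition Unif :: "('a uspace, 'a \<Rightarrow> 'a) cat" where
  "Unif = \<lparr> Obj = {S. Hausdorff_uniform_space S},
            Hom = (\<lambda>S T. {f \<in> extensional (points S). uniformly_continuous_map S T f}),
            Ident = (\<lambda>S. \<lambda>x\<in>points S. x),
            Comp = (\<lambda>S T V g f. compose (points S) g f) \<rparr>"

lemma is_category_Unif: "is_category Unif"
proof -
  have ev: "eventually (\<lambda>(x, y). x \<in> points S \<and> y \<in> points S) (entourages S)"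
    if "Hausdorff_uniform_space S" for S :: "'a uspace"
  proof -
    have "eventually (\<lambda>p. p \<in> points S \<times> points S) (entourages S)"
      using that by (auto simp: Hausdorff_uniform_space_def le_principal)
    then show ?thesis by eventually_elim auto
  qed
  have funcset: "f \<in> points S \<rightarrow> points T" if "uniformly_continuous_map S T f"
    for S T :: "'a uspace" and f
    using that by (auto simp: uniformly_continuous_map_def)
  have comp: "uniformly_continuous_map S V (compose (points S) g f)"
    if S: "Hausdorff_uniform_space S" and f: "uniformly_continuous_map S T f"
      and g: "uniformly_continuous_map T V g" for S T V :: "'a uspace" and f g
  proof -
    have "filterlim (\<lambda>p. (\<lambda>(x, y). (g x, g y)) ((\<lambda>(x, y). (f x, f y)) p)) (entourages V) (entourages S)"
      using f g unfolding uniformly_continuous_map_def by (auto intro: filterlim_compose)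
    moreover have "eventually (\<lambda>p. (\<lambda>(x, y). (g x, g y)) ((\<lambda>(x, y). (f x, f y)) p) =
       (\<lambda>(x, y). (compose (points S) g f x, compose (points S) g f y)) p) (entourages S)"
      using ev[OF S] by eventually_elim (auto simp: compose_def)
    ultimately show ?thesis
      using funcset_compose[OF funcset[OF f] funcset[OF g]]
      by (simp add: uniformly_continuous_map_def filterlim_cong)
  qed
  have ident: "uniformly_continuous_map S S (\<lambda>x\<in>points S. x)"
    if "Hausdorff_uniform_space S" for S :: "'a uspace"
  proof -
    have "eventually (\<lambda>p. p = (\<lambda>(x, y). ((\<lambda>x\<in>points S. x) x, (\<lambda>x\<in>points S. x) y)) p) (entourages S)"
      using ev[OF that] by eventually_elim auto
    from filterlim_cong[OF refl refl this, of "entourages S"] show ?thesis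
      by (simp add: uniformly_continuous_map_def filterlim_ident)
  qed
  show ?thesis
    unfolding is_category_def Unif_def cat.select_convs mem_Collect_eq
    by (intro conjI ballI; (elim CollectE conjE)?;
        (assumption | rule conjI comp ident Id_compose compose_Id compose_assoc[symmetric]
          compose_extensional restrict_extensional funcset)+)
qed

text \<open>A set is open iff with each of its points \<open>x\<close> it contains \<open>{y. (x, y) \<in> E}\<close> for some entourage
  \<open>E\<close>; compare \<open>open_uniformity\<close>.\<close>

definition uniform_topology :: "'a uspace \<Rightarrow> 'a topology" where
  "uniform_topology S = topology (\<lambda>W. W \<subseteq> points S \<and>
     (\<forall>x\<in>W. eventually (\<lambda>(x', y). x' = x \<longrightarrow> y \<in> W) (entourages S)))"

lemma openin_uniform_topology:
  "openin (uniform_topology S) W \<longleftrightarrow>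
     W \<subseteq> points S \<and> (\<forall>x\<in>W. eventually (\<lambda>(x', y). x' = x \<longrightarrow> y \<in> W) (entourages S))"
proof -
  have "istopology (\<lambda>W. W \<subseteq> points S \<and>
     (\<forall>x\<in>W. eventually (\<lambda>(x', y). x' = x \<longrightarrow> y \<in> W) (entourages S)))"
    unfolding istopology_def
  proof (intro conjI allI impI ballI; (elim conjE)?)
    fix V W x
    assume "\<forall>x\<in>V. eventually (\<lambda>(x', y). x' = x \<longrightarrow> y \<in> V) (entourages S)"
      "\<forall>x\<in>W. eventually (\<lambda>(x', y). x' = x \<longrightarrow> y \<in> W) (entourages S)" "x \<in> V \<inter> W"
    then have "eventually (\<lambda>(x', y). x' = x \<longrightarrow> y \<in> V) (entourages S)"
      "eventually (\<lambda>(x', y). x' = x \<longrightarrow> y \<in> W) (entourages S)" by auto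
    then show "eventually (\<lambda>(x', y). x' = x \<longrightarrow> y \<in> V \<inter> W) (entourages S)"
      by eventually_elim auto
  next
    fix \<K> x
    assume *: "\<forall>K\<in>\<K>. K \<subseteq> points S \<and>
      (\<forall>x\<in>K. eventually (\<lambda>(x', y). x' = x \<longrightarrow> y \<in> K) (entourages S))" and "x \<in> \<Union>\<K>"
    then obtain K where K: "K \<in> \<K>" "x \<in> K" by auto
    with * have "eventually (\<lambda>(x', y). x' = x \<longrightarrow> y \<in> K) (entourages S)" by auto
    then show "eventually (\<lambda>(x', y). x' = x \<longrightarrow> y \<in> \<Union>\<K>) (entourages S)"
      by eventually_elim (use K in auto)
  qed auto
  then show ?thesis
    by (simp add: uniform_topology_def topology_inverse')
qed

lemma topspace_uniform_topology:
  assumes "Hausdorff_uniform_space S"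
  shows "topspace (uniform_topology S) = points S"
proof -
  have "eventually (\<lambda>p. p \<in> points S \<times> points S) (entourages S)"
    using assms by (auto simp: Hausdorff_uniform_space_def le_principal)
  then have "eventually (\<lambda>(x', y). x' = x \<longrightarrow> y \<in> points S) (entourages S)" for x
    by eventually_elim auto
  then have "openin (uniform_topology S) (points S)"
    by (simp add: openin_uniform_topology)
  moreover have "topspace (uniform_topology S) \<subseteq> points S"
    using openin_topspace[of "uniform_topology S"] unfolding openin_uniform_topology by simp
  ultimately show ?thesis
    by (simp add: openin_subset subset_antisym)
qed

definition U_forget :: "('a uspace, 'a \<Rightarrow> 'a, 'a topology, 'a \<Rightarrow> 'a) fctr" where
  "U_forget = \<lparr> on_obj = uniform_topology, on_hom = (\<lambda>S T f. f) \<rparr>"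


section \<open>Spaces of probability measures\<close>

definition Borel_of :: "'a topology \<Rightarrow> 'a measure" where
  "Borel_of X = sigma (topspace X) {W. openin X W}"

text \<open>Regularity is inner approximation by closed sets; compactness of the approximating sets is
  the stronger Radon property.\<close>

definition regular_measure :: "'a topology \<Rightarrow> 'a measure \<Rightarrow> bool" where
  "regular_measure X M \<longleftrightarrow>
     (\<forall>B\<in>sets M. measure M B = (SUP F\<in>{F. closedin X F \<and> F \<subseteq> B}. measure M F))"

definition Radon_measure :: "'a topology \<Rightarrow> 'a measure \<Rightarrow> bool" where
  "Radon_measure X M \<longleftrightarrow>
     (\<forall>B\<in>sets M. measure M B = (SUP K\<in>{K. compactin X K \<and> K \<subseteq> B}. measure M K))"

text \<open>The limit of \<open>measure M F\<close> along a decreasing net of closed sets depends only on the family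
  \<open>\<F>\<close> of members of the net, which is downward directed. Such a family is
  itself a decreasing net, directed by reverse inclusion, and the filter below is its tail
  filter.\<close>

definition tau_smooth :: "'a topology \<Rightarrow> 'a measure \<Rightarrow> bool" where
  "tau_smooth X M \<longleftrightarrow>
     (\<forall>\<F>. \<F> \<noteq> {} \<and> (\<forall>F\<in>\<F>. closedin X F) \<and>
          (\<forall>F\<in>\<F>. \<forall>G\<in>\<F>. \<exists>H\<in>\<F>. H \<subseteq> F \<inter> G) \<and> \<Inter>\<F> = {} \<longrightarrow>
        (measure M \<longlongrightarrow> 0) (INF F\<in>\<F>. principal {G\<in>\<F>. G \<subseteq> F}))"

definition P_tau_set :: "'a topology \<Rightarrow> 'a measure set" where
  "P_tau_set X = {M. space M = topspace X \<and> sets M = sets (Borel_of X) \<and> prob_space M \<and>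
                     regular_measure X M \<and> tau_smooth X M}"

text \<open>The set \<open>P_tau_set X\<close> itself is among the generators (take \<open>W\<close> to be \<^term>\<open>UNIV :: real set\<close>),
  so it is the underlying set of this topology.\<close>

definition P_tau_top :: "'a topology \<Rightarrow> 'a measure topology" where
  "P_tau_top X = topology_generated_by
     {{M \<in> P_tau_set X. (\<integral>x. f x \<partial>M) \<in> W} | f W.
        continuous_map X euclideanreal f \<and> bounded (f ` topspace X) \<and> open W}"

lemma topspace_P_tau_top: "topspace (P_tau_top X) = P_tau_set X"
proof -
  have "P_tau_set X \<in> {{M \<in> P_tau_set X. (\<integral>x. f x \<partial>M) \<in> W} | f W.
        continuous_map X euclideanreal f \<and> bounded (f ` topspace X) \<and> open W}"
    by (rule CollectI, rule exI[of _ "\<lambda>_. 0"], rule exI[of _ UNIV])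
       (simp add: image_constant_conv)
  then show ?thesis
    unfolding P_tau_top_def topology_generated_by_topspace by blast
qed

definition P_hat_top :: "'a topology \<Rightarrow> 'a measure topology" where
  "P_hat_top X = subtopology (P_tau_top X) {M \<in> P_tau_set X. Radon_measure X M}"

text \<open>The type \<open>'a\<close> plays the role of a universe: \<^const>\<open>Tych\<close> and \<^const>\<open>Unif\<close> contain all
  spaces on subsets of \<open>'a\<close>. Since measures on \<open>'a\<close> form a larger type, the target of the functors is
  the same category over \<open>'a measure\<close>.\<close>

definition P_tau :: "('a topology, 'a \<Rightarrow> 'a, 'a measure topology, 'a measure \<Rightarrow> 'a measure) fctr" where
  "P_tau = \<lparr> on_obj = P_tau_top,
             on_hom = (\<lambda>X Y f. \<lambda>M\<in>topspace (P_tau_top X). distr M (Borel_of Y) f) \<rparr>"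

definition P_hat :: "('a topology, 'a \<Rightarrow> 'a, 'a measure topology, 'a measure \<Rightarrow> 'a measure) fctr" where
  "P_hat = \<lparr> on_obj = P_hat_top,
             on_hom = (\<lambda>X Y f. \<lambda>M\<in>topspace (P_hat_top X). distr M (Borel_of Y) f) \<rparr>"

end

theory Submission
  imports Defs
begin

text \<open>
The lift puts on \<open>P\<^sub>\<tau>(X)\<close>, for a uniform space \<open>X\<close>, the coarsest uniformity for which all maps
\<open>\<mu> \<mapsto> \<integral>g d\<mu>\<close> with \<open>g\<close> bounded and uniformly continuous are uniformly continuous, and restricts it to
the Radon measures for the functor of Radon measures. Functoriality is immediate: if \<open>f\<close> and \<open>g\<close> are uniformly continuous
then so is \<open>g \<circ> f\<close>, and the integral of \<open>g\<close> against the push-forward of \<open>\<mu>\<close> is that of \<open>g \<circ> f\<close> against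
\<open>\<mu>\<close> (\<open>uniformly_continuous_pushforward\<close>).

What has to be shown is that this uniformity induces the weak topology, which is defined with all
bounded continuous functions. Here \<open>\<tau>\<close>-smoothness enters. A bounded continuous function \<open>h \<ge> 0\<close> is the
pointwise supremum of the upward directed family of uniformly continuous \<open>g\<close> with \<open>0 \<le> g \<le> h\<close>, because
a uniform space has uniformly continuous bump functions at each point (\<open>ex_uniform_bump\<close>, by the chain
construction of pseudometrization). A \<open>\<tau>\<close>-smooth measure commutes with such suprema
(\<open>tau_smooth_lower_approximation\<close>), so the integral of \<open>h\<close> is lower semicontinuous for the topology of
the uniformity; the same for a constant minus \<open>h\<close> gives continuity (\<open>initial_topology_P_tau_top\<close>).

The argument uses only that the approximating functions form a directed family with bumps. It
therefore also applies to all bounded continuous functions on a Tychonoff space, where, used for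
indicators of open sets, it shows that integrals separate \<open>\<tau>\<close>-smooth measures
(\<open>P_tau_set_eqI\<close>), so that the spaces of measures are Tychonoff. That a push-forward is again a
regular measure also rests on \<open>\<tau>\<close>-smoothness, together with the regularity of the target space
(\<open>distr_in_P_tau_set\<close>).
\<close>

section \<open>Initial uniformities of real functions\<close>

text \<open>Bounding finitely many functions by one common \<open>e\<close> makes the generating entourages a filter base,
so that no finite intersections of generators have to be carried along.\<close>

definition initial_uniformity :: "'a set \<Rightarrow> ('a \<Rightarrow> real) set \<Rightarrow> 'a uspace" where
  "initial_uniformity Q \<Phi> = \<lparr> points = Q, entourages =
     (INF (A, e) \<in> {A. finite A \<and> A \<subseteq> \<Phi>} \<times> {0<..}.
        principal {(x, y) \<in> Q \<times> Q. \<forall>\<phi>\<in>A. \<bar>\<phi> x - \<phi> y\<bar> < e}) \<rparr>"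

lemma points_initial_uniformity [simp]: "points (initial_uniformity Q \<Phi>) = Q"
  by (simp add: initial_uniformity_def)

lemma eventually_initial_uniformity:
  "eventually E (entourages (initial_uniformity Q \<Phi>)) \<longleftrightarrow>
     (\<exists>A e. finite A \<and> A \<subseteq> \<Phi> \<and> e > 0 \<and>
        (\<forall>x\<in>Q. \<forall>y\<in>Q. (\<forall>\<phi>\<in>A. \<bar>\<phi> x - \<phi> y\<bar> < e) \<longrightarrow> E (x, y)))"
proof -
  let ?B = "{A. finite A \<and> A \<subseteq> \<Phi>} \<times> {0<..}"
  let ?F = "\<lambda>(A, e). principal {(x, y) \<in> Q \<times> Q. \<forall>\<phi>\<in>A. \<bar>\<phi> x - \<phi> y\<bar> < e}"
  have "\<exists>c\<in>?B. ?F c \<le> inf (?F a) (?F b)" if "a \<in> ?B" "b \<in> ?B" for a b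
    by (rule bexI[of _ "(fst a \<union> fst b, min (snd a) (snd b))"])
       (use that in \<open>auto split: prod.splits\<close>)
  moreover have "({}, 1 :: real) \<in> ?B" by simp
  ultimately have "eventually E (INF b\<in>?B. ?F b) \<longleftrightarrow> (\<exists>b\<in>?B. eventually E (?F b))"
    by (intro eventually_INF_base) blast+
  also have "\<dots> \<longleftrightarrow> (\<exists>A e. finite A \<and> A \<subseteq> \<Phi> \<and> e > 0 \<and>
        (\<forall>x\<in>Q. \<forall>y\<in>Q. (\<forall>\<phi>\<in>A. \<bar>\<phi> x - \<phi> y\<bar> < e) \<longrightarrow> E (x, y)))"
    by (simp add: eventually_principal Bex_def) blast
  finally show ?thesis
    by (simp add: initial_uniformity_def)
qed

text \<open>The filter axioms are inherited from \<open>\<real>\<close> along each \<open>\<phi>\<close>; only the separation axiom asks something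
of the family.\<close>

lemma Hausdorff_initial_uniformity:
  assumes sep: "\<And>x y. x \<in> Q \<Longrightarrow> y \<in> Q \<Longrightarrow> (\<And>\<phi>. \<phi> \<in> \<Phi> \<Longrightarrow> \<phi> x = \<phi> y) \<Longrightarrow> x = y"
  shows "Hausdorff_uniform_space (initial_uniformity Q \<Phi>)"
  unfolding Hausdorff_uniform_space_def points_initial_uniformity
proof (intro conjI allI impI ballI)
  show "entourages (initial_uniformity Q \<Phi>) \<le> principal (Q \<times> Q)"
    unfolding le_principal eventually_initial_uniformity
    by (intro exI[of _ "{}"] exI[of _ 1]) auto
next
  fix E x assume "eventually E (entourages (initial_uniformity Q \<Phi>))" "x \<in> Q"
  then show "E (x, x)"
    by (auto simp: eventually_initial_uniformity)
next
  fix E assume "eventually E (entourages (initial_uniformity Q \<Phi>))"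
  then obtain A e where "finite A" "A \<subseteq> \<Phi>" "e > 0"
    and "\<forall>x\<in>Q. \<forall>y\<in>Q. (\<forall>\<phi>\<in>A. \<bar>\<phi> x - \<phi> y\<bar> < e) \<longrightarrow> E (x, y)"
    unfolding eventually_initial_uniformity by blast
  then show "eventually (\<lambda>(x, y). E (y, x)) (entourages (initial_uniformity Q \<Phi>))"
    unfolding eventually_initial_uniformity
    by (intro exI[of _ A] exI[of _ e]) (simp add: abs_minus_commute)
next
  fix E assume "eventually E (entourages (initial_uniformity Q \<Phi>))"
  then obtain A e where A: "finite A" "A \<subseteq> \<Phi>" "e > 0"
    and E: "\<And>x y. x \<in> Q \<Longrightarrow> y \<in> Q \<Longrightarrow> (\<forall>\<phi>\<in>A. \<bar>\<phi> x - \<phi> y\<bar> < e) \<Longrightarrow> E (x, y)"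
    unfolding eventually_initial_uniformity by blast
  let ?D = "\<lambda>(x, y). x \<in> Q \<and> y \<in> Q \<and> (\<forall>\<phi>\<in>A. \<bar>\<phi> x - \<phi> y\<bar> < e / 2)"
  have "eventually ?D (entourages (initial_uniformity Q \<Phi>))"
    unfolding eventually_initial_uniformity
    by (intro exI[of _ A] exI[of _ "e / 2"]) (use A in auto)
  moreover have "E (x, z)" if D: "?D (x, y)" "?D (y, z)" for x y z
  proof (rule E)
    show "\<forall>\<phi>\<in>A. \<bar>\<phi> x - \<phi> z\<bar> < e"
    proof
      fix \<phi> assume "\<phi> \<in> A"
      then have "\<bar>\<phi> x - \<phi> y\<bar> < e / 2" "\<bar>\<phi> y - \<phi> z\<bar> < e / 2"
        using D by auto
      then show "\<bar>\<phi> x - \<phi> z\<bar> < e" by linarith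
    qed
  qed (use D in auto)
  ultimately show "\<exists>D. eventually D (entourages (initial_uniformity Q \<Phi>)) \<and>
      (\<forall>x y z. D (x, y) \<longrightarrow> D (y, z) \<longrightarrow> E (x, z))"
    by blast
next
  fix x y assume xy: "x \<in> Q" "y \<in> Q" "x \<noteq> y"
  with sep obtain \<phi> where \<phi>: "\<phi> \<in> \<Phi>" "\<phi> x \<noteq> \<phi> y" by blast
  let ?E = "\<lambda>(x', y'). \<bar>\<phi> x' - \<phi> y'\<bar> < \<bar>\<phi> x - \<phi> y\<bar>"
  have "eventually ?E (entourages (initial_uniformity Q \<Phi>))"
    unfolding eventually_initial_uniformity
    by (intro exI[of _ "{\<phi>}"] exI[of _ "\<bar>\<phi> x - \<phi> y\<bar>"]) (use \<phi> in auto)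
  then show "\<exists>E. eventually E (entourages (initial_uniformity Q \<Phi>)) \<and> \<not> E (x, y)"
    by (intro exI[of _ ?E]) auto
qed

text \<open>This criterion is what makes initial uniformities functorial: a map is uniformly continuous as soon as
it pulls the generators of its target back to generators of its source.\<close>

lemma uniformly_continuous_map_initial_uniformity:
  assumes f: "f \<in> Q \<rightarrow> Q'"
    and pull: "\<And>\<phi>. \<phi> \<in> \<Phi>' \<Longrightarrow> \<exists>\<psi>\<in>\<Phi>. \<forall>x\<in>Q. \<phi> (f x) = \<psi> x"
  shows "uniformly_continuous_map (initial_uniformity Q \<Phi>) (initial_uniformity Q' \<Phi>') f"
  unfolding uniformly_continuous_map_def points_initial_uniformity filterlim_iff
proof (intro conjI f allI impI)
  fix E assume "eventually E (entourages (initial_uniformity Q' \<Phi>'))"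
  then obtain A e where A: "finite A" "A \<subseteq> \<Phi>'" "e > 0"
    and E: "\<And>x y. x \<in> Q' \<Longrightarrow> y \<in> Q' \<Longrightarrow> (\<forall>\<phi>\<in>A. \<bar>\<phi> x - \<phi> y\<bar> < e) \<Longrightarrow> E (x, y)"
    unfolding eventually_initial_uniformity by blast
  from pull obtain p where p: "\<And>\<phi>. \<phi> \<in> \<Phi>' \<Longrightarrow> p \<phi> \<in> \<Phi>"
      "\<And>\<phi> x. \<phi> \<in> \<Phi>' \<Longrightarrow> x \<in> Q \<Longrightarrow> \<phi> (f x) = p \<phi> x" by metis
  show "eventually (\<lambda>xy. E (case xy of (x, y) \<Rightarrow> (f x, f y))) (entourages (initial_uniformity Q \<Phi>))"
    unfolding eventually_initial_uniformity
  proof (intro exI[of _ "p ` A"] exI[of _ e] conjI ballI impI)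
    fix x y assume xy: "x \<in> Q" "y \<in> Q" "\<forall>\<psi>\<in>p ` A. \<bar>\<psi> x - \<psi> y\<bar> < e"
    then have "E (f x, f y)"
      using A(2) f p(2) by (intro E) (auto simp: subset_eq)
    then show "E (case (x, y) of (x, y) \<Rightarrow> (f x, f y))" by simp
  qed (use A p in auto)
qed

text \<open>The space \<open>T\<close> carries the coarsest topology for which the functions in \<open>\<Phi>\<close> are continuous, expressed
by neighbourhoods in the form in which the entourages of \<^const>\<open>initial_uniformity\<close> are given.\<close>

definition initial_topology :: "'a topology \<Rightarrow> ('a \<Rightarrow> real) set \<Rightarrow> bool" where
  "initial_topology T \<Phi> \<longleftrightarrow>
     (\<forall>\<phi>\<in>\<Phi>. continuous_map T euclideanreal \<phi>) \<and>
     (\<forall>W x. openin T W \<longrightarrow> x \<in> W \<longrightarrow>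
        (\<exists>A e. finite A \<and> A \<subseteq> \<Phi> \<and> e > 0 \<and>
           (\<forall>y\<in>topspace T. (\<forall>\<phi>\<in>A. \<bar>\<phi> x - \<phi> y\<bar> < e) \<longrightarrow> y \<in> W)))"

lemma initial_topology_subtopology:
  assumes "initial_topology T \<Phi>"
  shows "initial_topology (subtopology T Q) \<Phi>"
  unfolding initial_topology_def
proof (intro conjI ballI allI impI)
  fix \<phi> assume "\<phi> \<in> \<Phi>"
  then show "continuous_map (subtopology T Q) euclideanreal \<phi>"
    using assms by (simp add: initial_topology_def continuous_map_from_subtopology)
next
  fix W x assume "openin (subtopology T Q) W" "x \<in> W"
  then obtain V where V: "openin T V" "W = V \<inter> Q" "x \<in> V"
    by (auto simp: openin_subtopology)
  then obtain A e where "finite A" "A \<subseteq> \<Phi>" "e > 0"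
      "\<forall>y\<in>topspace T. (\<forall>\<phi>\<in>A. \<bar>\<phi> x - \<phi> y\<bar> < e) \<longrightarrow> y \<in> V"
    using assms unfolding initial_topology_def by blast
  then show "\<exists>A e. finite A \<and> A \<subseteq> \<Phi> \<and> e > 0 \<and>
      (\<forall>y\<in>topspace (subtopology T Q). (\<forall>\<phi>\<in>A. \<bar>\<phi> x - \<phi> y\<bar> < e) \<longrightarrow> y \<in> W)"
    using V(2) by (intro exI[of _ A] exI[of _ e]) auto
qed

lemma openin_basic_neighbourhood:
  assumes "finite A" "\<And>\<phi>. \<phi> \<in> A \<Longrightarrow> continuous_map T euclideanreal \<phi>"
  shows "openin T {y \<in> topspace T. \<forall>\<phi>\<in>A. \<bar>\<phi> x - \<phi> y\<bar> < (e::real)}"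
proof -
  have "{y \<in> topspace T. \<forall>\<phi>\<in>A. \<bar>\<phi> x - \<phi> y\<bar> < e} =
      topspace T \<inter> (\<Inter>\<phi>\<in>A. {y \<in> topspace T. \<phi> y \<in> ball (\<phi> x) e})"
    by (auto simp: dist_real_def)
  moreover have "openin T {y \<in> topspace T. \<phi> y \<in> ball (\<phi> x) e}" if "\<phi> \<in> A" for \<phi>
    using assms(2)[OF that] by (rule openin_continuous_map_preimage) auto
  ultimately show ?thesis
    using assms(1) by (cases "A = {}") (auto intro!: openin_Int openin_Inter)
qed

lemma uniform_topology_initial_uniformity:
  assumes "initial_topology T \<Phi>"
  shows "uniform_topology (initial_uniformity (topspace T) \<Phi>) = T"
  unfolding topology_eq
proof (intro allI iffI)
  fix W assume W: "openin (uniform_topology (initial_uniformity (topspace T) \<Phi>)) W"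
  show "openin T W"
  proof (subst openin_subopen, intro ballI)
    fix x assume x: "x \<in> W"
    with W have xT: "x \<in> topspace T"
      by (auto simp: openin_uniform_topology)
    from W x obtain A e where A: "finite A" "A \<subseteq> \<Phi>" "e > 0"
      and E: "\<forall>x'\<in>topspace T. \<forall>y\<in>topspace T. (\<forall>\<phi>\<in>A. \<bar>\<phi> x' - \<phi> y\<bar> < e) \<longrightarrow>
        (case (x', y) of (x', y) \<Rightarrow> x' = x \<longrightarrow> y \<in> W)"
      unfolding openin_uniform_topology eventually_initial_uniformity by blast
    show "\<exists>V. openin T V \<and> x \<in> V \<and> V \<subseteq> W"
      using openin_basic_neighbourhood[of A T x e] A E xT assms
      by (intro exI[of _ "{y \<in> topspace T. \<forall>\<phi>\<in>A. \<bar>\<phi> x - \<phi> y\<bar> < e}"])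
         (auto simp: initial_topology_def subset_eq)
  qed
next
  fix W assume W: "openin T W"
  show "openin (uniform_topology (initial_uniformity (topspace T) \<Phi>)) W"
    unfolding openin_uniform_topology points_initial_uniformity eventually_initial_uniformity
  proof (intro conjI ballI)
    fix x assume "x \<in> W"
    then obtain A e where "finite A" "A \<subseteq> \<Phi>" "e > 0"
        "\<forall>y\<in>topspace T. (\<forall>\<phi>\<in>A. \<bar>\<phi> x - \<phi> y\<bar> < e) \<longrightarrow> y \<in> W"
      using assms W unfolding initial_topology_def by blast
    then show "\<exists>A e. finite A \<and> A \<subseteq> \<Phi> \<and> e > 0 \<and>
        (\<forall>x'\<in>topspace T. \<forall>y\<in>topspace T. (\<forall>\<phi>\<in>A. \<bar>\<phi> x' - \<phi> y\<bar> < e) \<longrightarrow>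
          (case (x', y) of (x', y) \<Rightarrow> x' = x \<longrightarrow> y \<in> W))"
      by (intro exI[of _ A] exI[of _ e]) auto
  qed (use W openin_subset in blast)
qed

text \<open>A point is separated from a closed set \<open>C\<close> by the sum of the finitely many deviations
\<open>\<bar>\<phi> x - \<phi> y\<bar>\<close> that define a neighbourhood of \<open>x\<close> missing \<open>C\<close>, scaled and cut off at \<open>1\<close>.\<close>

lemma Tychonoff_initial_topology:
  assumes T: "initial_topology T \<Phi>"
    and sep: "\<And>x y. x \<in> topspace T \<Longrightarrow> y \<in> topspace T \<Longrightarrow>
      (\<And>\<phi>. \<phi> \<in> \<Phi> \<Longrightarrow> \<phi> x = \<phi> y) \<Longrightarrow> x = y"
  shows "Tychonoff_space T"
  unfolding Tychonoff_space_def
proof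
  show "completely_regular_space T"
    unfolding completely_regular_space_def
  proof (intro allI impI, elim conjE)
    fix C x assume C: "closedin T C" and x: "x \<in> topspace T - C"
    then have "openin T (topspace T - C)" by blast
    with T x obtain A e where A: "finite A" "A \<subseteq> \<Phi>" "e > 0"
      and E: "\<forall>y\<in>topspace T. (\<forall>\<phi>\<in>A. \<bar>\<phi> x - \<phi> y\<bar> < e) \<longrightarrow> y \<in> topspace T - C"
      unfolding initial_topology_def by blast
    define f where "f y = min 1 ((\<Sum>\<phi>\<in>A. \<bar>\<phi> x - \<phi> y\<bar>) / e)" for y
    have "continuous_map T euclideanreal f"
      unfolding f_def using A T
      by (intro continuous_map_real_min continuous_map_real_divide continuous_map_sum
            continuous_map_real_abs continuous_map_diff) (auto simp: initial_topology_def)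
    then have "continuous_map T (top_of_set {0..1}) f"
      using A(3) by (auto simp: continuous_map_in_subtopology f_def intro!: sum_nonneg)
    moreover have "f x = 0" by (simp add: f_def)
    moreover have "f y = 1" if y: "y \<in> C" for y
    proof -
      have "y \<in> topspace T" using C y closedin_subset by blast
      with E y obtain \<phi> where \<phi>: "\<phi> \<in> A" "\<bar>\<phi> x - \<phi> y\<bar> \<ge> e"
        by (meson DiffD2 not_less)
      have "\<bar>\<phi> x - \<phi> y\<bar> \<le> (\<Sum>\<phi>\<in>A. \<bar>\<phi> x - \<phi> y\<bar>)"
        using A(1) \<phi>(1) by (intro member_le_sum) auto
      with \<phi>(2) A(3) show ?thesis
        by (auto simp: f_def min_def field_simps)
    qed
    ultimately show "\<exists>f::'a \<Rightarrow> real. continuous_map T (top_of_set {0..1}) f \<and> f x = 0 \<and> f ` C \<subseteq> {1}"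
      by blast
  qed
next
  show "Hausdorff_space T"
    unfolding Hausdorff_space_def
  proof (intro allI impI, elim conjE)
    fix x y assume xy: "x \<in> topspace T" "y \<in> topspace T" "x \<noteq> y"
    with sep obtain \<phi> where \<phi>: "\<phi> \<in> \<Phi>" "\<phi> x \<noteq> \<phi> y" by blast
    then obtain U V where UV: "open U" "open V" "\<phi> x \<in> U" "\<phi> y \<in> V" "U \<inter> V = {}"
      by (meson hausdorff)
    have c: "continuous_map T euclideanreal \<phi>"
      using T \<phi> by (simp add: initial_topology_def)
    show "\<exists>U V. openin T U \<and> openin T V \<and> x \<in> U \<and> y \<in> V \<and> disjnt U V"
      using xy UV openin_continuous_map_preimage[OF c, of U] openin_continuous_map_preimage[OF c, of V]
      by (intro exI[of _ "{z \<in> topspace T. \<phi> z \<in> U}"] exI[of _ "{z \<in> topspace T. \<phi> z \<in> V}"])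
         (auto simp: disjnt_def)
  qed
qed

section \<open>Borel measures, \<open>\<tau>\<close>-smoothness and regularity\<close>

lemma sets_Borel_of: "sets (Borel_of X) = sigma_sets (topspace X) {W. openin X W}"
  unfolding Borel_of_def by (rule sets_measure_of) (auto dest: openin_subset)

lemma space_Borel_of [simp]: "space (Borel_of X) = topspace X"
  unfolding Borel_of_def by (rule space_measure_of) (auto dest: openin_subset)

lemma openin_in_Borel_of: "openin X W \<Longrightarrow> W \<in> sets (Borel_of X)"
  by (simp add: sets_Borel_of sigma_sets.Basic)

lemma closedin_in_Borel_of:
  assumes "closedin X C"
  shows "C \<in> sets (Borel_of X)"
proof -
  have "C = topspace X - (topspace X - C)"
    using closedin_subset[OF assms] by blast
  moreover have "topspace X - C \<in> sets (Borel_of X)"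
    using assms by (intro openin_in_Borel_of) auto
  ultimately show ?thesis
    by (metis sets.compl_sets space_Borel_of)
qed

lemma continuous_map_measurable_Borel_of:
  assumes "continuous_map X Y f" "sets M = sets (Borel_of X)"
  shows "f \<in> measurable M (Borel_of Y)"
proof -
  have sp: "space M = topspace X"
    using sets_eq_imp_space_eq[OF assms(2)] by simp
  show ?thesis
    unfolding Borel_of_def
  proof (rule measurable_measure_of)
    show "f \<in> space M \<rightarrow> topspace Y"
      using assms(1) by (auto simp: sp continuous_map_def)
    fix y assume "y \<in> {W. openin Y W}"
    then have "openin X {x \<in> topspace X. f x \<in> y}"
      using assms(1) by (auto intro: openin_continuous_map_preimage)
    moreover have "f -` y \<inter> space M = {x \<in> topspace X. f x \<in> y}" by (auto simp: sp)
    ultimately show "f -` y \<inter> space M \<in> sets M"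
      by (simp add: assms(2) openin_in_Borel_of)
  qed (auto dest: openin_subset)
qed

lemma continuous_map_borel_measurable:
  fixes f :: "'a \<Rightarrow> real"
  assumes "continuous_map X euclideanreal f" "sets M = sets (Borel_of X)"
  shows "f \<in> borel_measurable M"
proof (rule borel_measurableI)
  fix S :: "real set" assume "open S"
  then have "openin X {x \<in> topspace X. f x \<in> S}"
    using assms(1) by (auto intro: openin_continuous_map_preimage)
  moreover have "f -` S \<inter> space M = {x \<in> topspace X. f x \<in> S}"
    using sets_eq_imp_space_eq[OF assms(2)] by auto
  ultimately show "f -` S \<inter> space M \<in> sets M"
    by (simp add: assms(2) openin_in_Borel_of)
qed

text \<open>The measures of a downward directed family of closed sets decrease along the family, so convergence to
\<open>0\<close> only asks for members of arbitrarily small measure.\<close>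

lemma tau_smooth_iff:
  assumes M: "finite_measure M" "sets M = sets (Borel_of X)"
  shows "tau_smooth X M \<longleftrightarrow>
     (\<forall>\<F>. \<F> \<noteq> {} \<and> (\<forall>F\<in>\<F>. closedin X F) \<and> (\<forall>F\<in>\<F>. \<forall>G\<in>\<F>. \<exists>H\<in>\<F>. H \<subseteq> F \<inter> G) \<and> \<Inter>\<F> = {} \<longrightarrow>
        (\<forall>e>0. \<exists>F\<in>\<F>. measure M F < e))"
proof -
  interpret finite_measure M by fact
  have "(measure M \<longlongrightarrow> 0) (INF F\<in>\<F>. principal {G\<in>\<F>. G \<subseteq> F}) \<longleftrightarrow> (\<forall>e>0. \<exists>F\<in>\<F>. measure M F < e)"
    if \<F>: "\<F> \<noteq> {}" "\<forall>F\<in>\<F>. closedin X F" "\<forall>F\<in>\<F>. \<forall>G\<in>\<F>. \<exists>H\<in>\<F>. H \<subseteq> F \<inter> G" for \<F>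
  proof -
    have "eventually P (INF F\<in>\<F>. principal {G\<in>\<F>. G \<subseteq> F}) \<longleftrightarrow> (\<exists>F\<in>\<F>. \<forall>G\<in>\<F>. G \<subseteq> F \<longrightarrow> P G)" for P
    proof (subst eventually_INF_base)
      fix F G assume "F \<in> \<F>" "G \<in> \<F>"
      then obtain H where "H \<in> \<F>" "H \<subseteq> F \<inter> G" using \<F>(3) by blast
      then show "\<exists>H\<in>\<F>. principal {G' \<in> \<F>. G' \<subseteq> H} \<le>
          inf (principal {G' \<in> \<F>. G' \<subseteq> F}) (principal {G' \<in> \<F>. G' \<subseteq> G})"
        by (intro bexI[of _ H]) auto
    qed (auto simp: \<F>(1) eventually_principal)
    moreover have "(\<exists>F\<in>\<F>. \<forall>G\<in>\<F>. G \<subseteq> F \<longrightarrow> measure M G < e) \<longleftrightarrow> (\<exists>F\<in>\<F>. measure M F < e)" for e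
    proof
      assume "\<exists>F\<in>\<F>. measure M F < e"
      then obtain F where F: "F \<in> \<F>" "measure M F < e" by blast
      then have "measure M G \<le> measure M F" if "G \<subseteq> F" for G
        using that \<F>(2) M(2) by (intro finite_measure_mono) (auto intro: closedin_in_Borel_of)
      with F(2) have "\<forall>G\<in>\<F>. G \<subseteq> F \<longrightarrow> measure M G < e" by (meson le_less_trans)
      with F(1) show "\<exists>F\<in>\<F>. \<forall>G\<in>\<F>. G \<subseteq> F \<longrightarrow> measure M G < e" by (rule rev_bexI)
    qed blast
    ultimately show ?thesis
      unfolding tendsto_iff by (simp only: dist_real_def diff_0_right abs_of_nonneg[OF measure_nonneg])
  qed
  then show ?thesis
    unfolding tau_smooth_def by (intro all_cong1 imp_cong refl) auto
qed

lemma regular_measureD: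
  assumes M: "finite_measure M" "sets M = sets (Borel_of X)" "regular_measure X M"
    and B: "B \<in> sets M" and e: "e > 0"
  obtains F where "closedin X F" "F \<subseteq> B" "measure M (B - F) < e"
proof -
  interpret finite_measure M by fact
  let ?S = "measure M ` {F. closedin X F \<and> F \<subseteq> B}"
  have "?S \<noteq> {}" by auto
  moreover have "measure M B - e < Sup ?S"
    using M(3) B e unfolding regular_measure_def by auto
  ultimately obtain s where "s \<in> ?S" "measure M B - e < s"
    by (meson less_cSupD)
  then obtain F where F: "closedin X F" "F \<subseteq> B" "measure M B - e < measure M F" by auto
  then have "measure M (B - F) = measure M B - measure M F"
    using B M(2) by (intro finite_measure_Diff) (auto intro: closedin_in_Borel_of)
  with F that show thesis by auto
qed

lemma inner_approximation_SUP:
  assumes M: "finite_measure M" and B: "B \<in> sets M"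
    and \<K>: "\<And>K. K \<in> \<K> \<Longrightarrow> K \<subseteq> B"
    and approx: "\<And>e. e > 0 \<Longrightarrow> \<exists>K\<in>\<K>. measure M B < measure M K + e"
  shows "measure M B = (SUP K\<in>\<K>. measure M K)"
proof (rule antisym)
  interpret finite_measure M by fact
  have le: "measure M K \<le> measure M B" if "K \<in> \<K>" for K
    using \<K>[OF that] B by (intro finite_measure_mono)
  have ne: "\<K> \<noteq> {}" using approx[of 1] by auto
  show "(SUP K\<in>\<K>. measure M K) \<le> measure M B"
    using ne le by (intro cSUP_least) auto
  show "measure M B \<le> (SUP K\<in>\<K>. measure M K)"
  proof (rule field_le_epsilon)
    fix e :: real assume "e > 0"
    then obtain K where K: "K \<in> \<K>" "measure M B < measure M K + e" using approx by blast
    moreover have "measure M K \<le> (SUP K\<in>\<K>. measure M K)"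
      using K(1) le by (intro cSUP_upper bdd_aboveI2[where M = "measure M B"])
    ultimately show "measure M B \<le> (SUP K\<in>\<K>. measure M K) + e" by linarith
  qed
qed

text \<open>The sets that can be enclosed between a closed and an open set of nearly equal measure form a
\<open>\<sigma>\<close>-algebra: complements exchange the two approximants, and a countable union distributes the error
geometrically. Open sets serve as their own outer approximants.\<close>

lemma regular_measure_if_regular_on_opens:
  assumes M: "finite_measure M" "sets M = sets (Borel_of X)"
    and opens: "\<And>U e. openin X U \<Longrightarrow> e > 0 \<Longrightarrow>
      \<exists>F. closedin X F \<and> F \<subseteq> U \<and> measure M (U - F) < e"
  shows "regular_measure X M"
proof -
  interpret finite_measure M by fact
  have clm: "F \<in> sets M" if "closedin X F" for F
    using that M(2) closedin_in_Borel_of by simp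
  have opm: "W \<in> sets M" if "openin X W" for W
    using that M(2) openin_in_Borel_of by simp
  have sandwich: "\<forall>e>0. \<exists>F W. closedin X F \<and> openin X W \<and> F \<subseteq> B \<and> B \<subseteq> W \<and> measure M (W - F) < e"
    if "B \<in> sigma_sets (topspace X) {W. openin X W}" for B
    using that
  proof induction
    case (Basic a)
    then have "openin X a" by simp
    with opens[of a] show ?case by blast
  next
    case Empty
    show ?case by (intro allI impI exI[of _ "{}"]) simp
  next
    case (Compl a)
    show ?case
    proof (intro allI impI)
      fix e :: real assume "e > 0"
      then obtain F W where FW: "closedin X F" "openin X W" "F \<subseteq> a" "a \<subseteq> W" "measure M (W - F) < e"
        using Compl.IH[rule_format, OF \<open>e > 0\<close>] by (elim exE conjE)
      have "(topspace X - F) - (topspace X - W) = W - F"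
        using openin_subset[OF FW(2)] by blast
      with FW show "\<exists>F W. closedin X F \<and> openin X W \<and> F \<subseteq> topspace X - a \<and> topspace X - a \<subseteq> W \<and>
          measure M (W - F) < e"
        by (intro exI[of _ "topspace X - W"] exI[of _ "topspace X - F"])
          (auto simp del: Diff_iff intro: Diff_mono)
    qed
  next
    case (Union a)
    show ?case
    proof (intro allI impI)
      fix e :: real assume e: "e > 0"
      have "\<forall>i. \<exists>F W. closedin X F \<and> openin X W \<and> F \<subseteq> a i \<and> a i \<subseteq> W \<and>
          measure M (W - F) < e / 2 * (1/2) ^ Suc i"
      proof
        fix i
        have "e / 2 * (1/2) ^ Suc i > 0" using e by simp
        then show "\<exists>F W. closedin X F \<and> openin X W \<and> F \<subseteq> a i \<and> a i \<subseteq> W \<and>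
            measure M (W - F) < e / 2 * (1/2) ^ Suc i"
          using Union.IH[of i] by (elim allE impE) assumption+
      qed
      then obtain F W where F: "\<And>i. closedin X (F i)" and W: "\<And>i. openin X (W i)"
        and sub: "\<And>i. F i \<subseteq> a i" "\<And>i. a i \<subseteq> W i"
        and d: "\<And>i. measure M (W i - F i) < e / 2 * (1/2) ^ Suc i" by metis
      have Fm: "\<And>i. F i \<in> sets M" and Wm: "\<And>i. W i \<in> sets M" using F W clm opm by blast+
      \<comment> \<open>A countable union of closed sets need not be closed: cut it off after \<open>n\<close> terms, where
        continuity from above makes the rest smaller than \<open>e / 2\<close>.\<close>
      let ?R = "\<lambda>n. (\<Union>i. W i) - (\<Union>i\<le>n. F i)"
      have conv: "(\<lambda>n. measure M (?R n)) \<longlonglongrightarrow> measure M (\<Inter>n. ?R n)"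
        using Fm Wm by (intro finite_Lim_measure_decseq) (force simp: decseq_def)+
      have "measure M (\<Inter>n. ?R n) \<le> e / 2"
      proof -
        have geo: "(\<lambda>i. e / 2 * (1/2) ^ Suc i) sums (e / 2 * 1)"
          by (rule sums_mult[OF power_half_series])
        have le: "measure M (W i - F i) \<le> e / 2 * (1/2) ^ Suc i" for i
          using d[of i] by linarith
        have sm: "summable (\<lambda>i. measure M (W i - F i))"
          by (rule summable_comparison_test'[OF sums_summable[OF geo], of 0]) (use le in simp)
        have "(\<Inter>n. ?R n) \<subseteq> (\<Union>i. W i - F i)"
        proof
          fix x assume x: "x \<in> (\<Inter>n. ?R n)"
          then obtain i where "x \<in> W i" by blast
          moreover from x have "x \<notin> F i" by blast
          ultimately show "x \<in> (\<Union>i. W i - F i)" by blast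
        qed
        then have "measure M (\<Inter>n. ?R n) \<le> measure M (\<Union>i. W i - F i)"
          using Fm Wm by (intro finite_measure_mono sets.countable_UN) blast+
        also have "\<dots> \<le> (\<Sum>i. measure M (W i - F i))"
          using Fm Wm by (intro finite_measure_subadditive_countably sm) blast
        also have "\<dots> \<le> (\<Sum>i. e / 2 * (1/2) ^ Suc i)"
          by (rule suminf_le[OF le sm sums_summable[OF geo]])
        also have "\<dots> = e / 2"
          using sums_unique[OF geo] by simp
        finally show ?thesis .
      qed
      with e have "measure M (\<Inter>n. ?R n) < e" by linarith
      then obtain n where n: "measure M (?R n) < e"
        using eventually_happens'[OF sequentially_bot order_tendstoD(2)[OF conv]] by blast
      have "closedin X (\<Union>i\<le>n. F i)" by (intro closedin_Union) (use F in auto)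
      moreover have "openin X (\<Union>i. W i)" by (intro openin_Union) (use W in auto)
      moreover have "(\<Union>i\<le>n. F i) \<subseteq> (\<Union>i. a i)" "(\<Union>i. a i) \<subseteq> (\<Union>i. W i)" using sub by blast+
      ultimately show "\<exists>F W. closedin X F \<and> openin X W \<and> F \<subseteq> \<Union> (range a) \<and> \<Union> (range a) \<subseteq> W \<and>
          measure M (W - F) < e"
        using n by blast
    qed
  qed
  show ?thesis
    unfolding regular_measure_def
  proof (intro ballI inner_approximation_SUP M)
    fix B and e :: real assume B: "B \<in> sets M" and "e > 0"
    with sandwich[of B] M(2) obtain F W where FW: "closedin X F" "openin X W" "F \<subseteq> B" "B \<subseteq> W"
      "measure M (W - F) < e" by (auto simp: sets_Borel_of)
    note [measurable] = clm[OF FW(1)] opm[OF FW(2)]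
    have "measure M B \<le> measure M (F \<union> (W - F))"
      using FW by (intro finite_measure_mono) auto
    also have "\<dots> \<le> measure M F + measure M (W - F)"
      using FW by (intro measure_Un_le) auto
    finally show "\<exists>K\<in>{F. closedin X F \<and> F \<subseteq> B}. measure M B < measure M K + e"
      using FW by force
  qed auto
qed

lemma P_tau_setD:
  assumes "M \<in> P_tau_set X"
  shows "space M = topspace X" "sets M = sets (Borel_of X)" "prob_space M" "finite_measure M"
    "regular_measure X M" "tau_smooth X M"
  using assms unfolding P_tau_set_def by (auto intro: prob_space.finite_measure)

lemma P_tau_set_directedD:
  assumes M: "M \<in> P_tau_set X"
    and ne: "\<F> \<noteq> {}"
    and closed: "\<And>F. F \<in> \<F> \<Longrightarrow> closedin X F"
    and directed: "\<And>F G. F \<in> \<F> \<Longrightarrow> G \<in> \<F> \<Longrightarrow> \<exists>H\<in>\<F>. H \<subseteq> F \<inter> G"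
    and empty: "\<Inter>\<F> = {}" and e: "e > 0"
  shows "\<exists>F\<in>\<F>. measure M F < e"
proof -
  have "\<F> \<noteq> {} \<and> (\<forall>F\<in>\<F>. closedin X F) \<and>
      (\<forall>F\<in>\<F>. \<forall>G\<in>\<F>. \<exists>H\<in>\<F>. H \<subseteq> F \<inter> G) \<and> \<Inter>\<F> = {}"
    using ne empty by (intro conjI ballI closed directed)
  then have "\<forall>e>0. \<exists>F\<in>\<F>. measure M F < e"
    by (rule P_tau_setD(6)[OF M, unfolded tau_smooth_iff[OF P_tau_setD(4,2)[OF M]], THEN spec, THEN mp])
  with e show ?thesis by simp
qed

text \<open>Preimages of closed sets are closed, so \<open>\<tau>\<close>-smoothness passes to the push-forward at once. Images
of closed sets need not be closed, so regularity cannot be transported in the same way. It is recovered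
from \<open>\<tau>\<close>-smoothness: in a regular space an open set \<open>U\<close> is the union of an upward directed family
of open sets each of which is contained in a closed subset of \<open>U\<close>.\<close>

lemma distr_in_P_tau_set:
  assumes M: "M \<in> P_tau_set X" and f: "continuous_map X Y f" and Y: "regular_space Y"
  shows "distr M (Borel_of Y) f \<in> P_tau_set Y"
proof -
  note MD = P_tau_setD[OF M]
  interpret prob_space M by (rule MD)
  let ?N = "distr M (Borel_of Y) f"
  have fm: "f \<in> measurable M (Borel_of Y)"
    using f MD(2) by (rule continuous_map_measurable_Borel_of)
  have N: "prob_space ?N" "sets ?N = sets (Borel_of Y)" "space ?N = topspace Y"
    using prob_space_distr[OF fm] by auto
  then have Nf: "finite_measure ?N" by (simp add: prob_space.finite_measure)
  let ?pre = "\<lambda>B. {x \<in> topspace X. f x \<in> B}"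
  have meas: "measure ?N B = measure M (?pre B)" if "B \<in> sets (Borel_of Y)" for B
  proof -
    have "f -` B \<inter> space M = ?pre B" by (auto simp: MD(1))
    with measure_distr[OF fm that] show ?thesis by simp
  qed
  have clpre: "closedin X (?pre F)" if "closedin Y F" for F
    using f that by (rule closedin_continuous_map_preimage)
  have oppre: "openin X (?pre F)" if "openin Y F" for F
    using f that by (rule openin_continuous_map_preimage)
  have "tau_smooth Y ?N"
    unfolding tau_smooth_iff[OF Nf N(2)]
  proof (intro allI impI, elim conjE)
    fix \<F> and e :: real
    assume \<F>: "\<F> \<noteq> {}" "\<forall>F\<in>\<F>. closedin Y F" "\<forall>F\<in>\<F>. \<forall>G\<in>\<F>. \<exists>H\<in>\<F>. H \<subseteq> F \<inter> G" "\<Inter>\<F> = {}" and e: "e > 0"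
    have "\<exists>F\<in>?pre ` \<F>. measure M F < e"
    proof (rule P_tau_set_directedD[OF M])
      fix F' G' assume "F' \<in> ?pre ` \<F>" "G' \<in> ?pre ` \<F>"
      then obtain F G where FG: "F \<in> \<F>" "G \<in> \<F>" "F' = ?pre F" "G' = ?pre G" by blast
      then obtain H where "H \<in> \<F>" "H \<subseteq> F \<inter> G" using \<F>(3) by blast
      then show "\<exists>H\<in>?pre ` \<F>. H \<subseteq> F' \<inter> G'"
        unfolding FG(3,4) by (intro bexI[of _ "?pre H"]) auto
    next
      show "\<Inter> (?pre ` \<F>) = {}" using \<F>(1,4) by auto
    qed (use \<F> e clpre in auto)
    then show "\<exists>F\<in>\<F>. measure ?N F < e"
      using \<F>(2) by (auto simp: meas closedin_in_Borel_of)
  qed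
  moreover have "regular_measure Y ?N"
  proof (rule regular_measure_if_regular_on_opens[OF Nf N(2)])
    fix U and e :: real assume U: "openin Y U" and e: "e > 0"
    have "?pre U \<in> sets M" by (simp add: MD(2) oppre U openin_in_Borel_of)
    from regular_measureD[OF MD(4,2,5) this, of "e/2"] e
    obtain C where C: "closedin X C" "C \<subseteq> ?pre U" "measure M (?pre U - C) < e/2" by auto
    \<comment> \<open>Since \<open>Y\<close> is regular, the open sets squeezed into \<open>U\<close> by a closed set exhaust \<open>U\<close>; their
      preimages exhaust \<open>C\<close> up to measure \<open>e / 2\<close> by \<open>\<tau>\<close>-smoothness.\<close>
    define \<V> where "\<V> = {V. openin Y V \<and> (\<exists>K. closedin Y K \<and> V \<subseteq> K \<and> K \<subseteq> U)}"
    have "\<exists>F\<in>(\<lambda>V. C - ?pre V) ` \<V>. measure M F < e/2"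
    proof (rule P_tau_set_directedD[OF M])
      have "openin Y {}" "closedin Y {} \<and> {} \<subseteq> U" by simp_all
      then have "{} \<in> \<V>" unfolding \<V>_def by blast
      then show "(\<lambda>V. C - ?pre V) ` \<V> \<noteq> {}" by blast
      show "closedin X F" if "F \<in> (\<lambda>V. C - ?pre V) ` \<V>" for F
        using that C(1) oppre by (auto simp: \<V>_def)
      show "\<exists>H\<in>(\<lambda>V. C - ?pre V) ` \<V>. H \<subseteq> F \<inter> G"
        if "F \<in> (\<lambda>V. C - ?pre V) ` \<V>" "G \<in> (\<lambda>V. C - ?pre V) ` \<V>" for F G
      proof -
        from that obtain V V' where FG: "V \<in> \<V>" "V' \<in> \<V>" "F = C - ?pre V" "G = C - ?pre V'" by blast
        then obtain K K' where a: "openin Y V" "closedin Y K" "V \<subseteq> K" "K \<subseteq> U"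
          "openin Y V'" "closedin Y K'" "V' \<subseteq> K'" "K' \<subseteq> U" unfolding \<V>_def by blast
        have "closedin Y (K \<union> K') \<and> V \<union> V' \<subseteq> K \<union> K' \<and> K \<union> K' \<subseteq> U" using a by auto
        with a have "V \<union> V' \<in> \<V>" unfolding \<V>_def by blast
        then show ?thesis
          unfolding FG(3,4) by (rule rev_image_eqI[THEN rev_bexI, OF _ refl]) auto
      qed
      show "\<Inter> ((\<lambda>V. C - ?pre V) ` \<V>) = {}"
      proof (intro equals0I)
        fix x assume "x \<in> \<Inter> ((\<lambda>V. C - ?pre V) ` \<V>)"
        then have x: "x \<in> C - ?pre V" if "V \<in> \<V>" for V using that by (rule INT_D)
        from x[OF \<open>{} \<in> \<V>\<close>] have "x \<in> C" by simp
        then have fx: "f x \<in> U" "x \<in> topspace X" using C(2) by auto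
        have "closedin Y (topspace Y - U)" "f x \<in> topspace Y - (topspace Y - U)"
          using U fx openin_subset[OF U] by auto
        with Y obtain V W where VW: "openin Y V" "openin Y W" "f x \<in> V" "topspace Y - U \<subseteq> W" "disjnt V W"
          unfolding regular_space_def by meson
        have "closedin Y (topspace Y - W)" using VW(2) by blast
        moreover have "V \<subseteq> topspace Y - W" using openin_subset[OF VW(1)] VW(5) by (auto simp: disjnt_def)
        moreover have "topspace Y - W \<subseteq> U" using VW(4) by blast
        ultimately have "V \<in> \<V>" using VW(1) unfolding \<V>_def by blast
        from x[OF this] fx VW(3) show False by simp
      qed
    qed (use e in simp)
    then obtain V where "V \<in> \<V>" and V: "measure M (C - ?pre V) < e/2" by blast
    then obtain K where VK: "openin Y V" "closedin Y K" "V \<subseteq> K" "K \<subseteq> U"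
      unfolding \<V>_def by blast
    have pUC: "?pre U - C \<in> sets M"
      using oppre[OF U] C(1) by (simp add: MD(2) sets.Diff openin_in_Borel_of closedin_in_Borel_of)
    have CpV: "C - ?pre V \<in> sets M"
      using oppre[OF VK(1)] C(1) by (simp add: MD(2) sets.Diff openin_in_Borel_of closedin_in_Borel_of)
    have UK: "U - K \<in> sets (Borel_of Y)"
      using U VK(2) by (simp add: sets.Diff openin_in_Borel_of closedin_in_Borel_of)
    have "measure ?N (U - K) = measure M (?pre (U - K))"
      using UK by (rule meas)
    also have "\<dots> \<le> measure M ((?pre U - C) \<union> (C - ?pre V))"
      using pUC CpV VK(3) by (intro finite_measure_mono) auto
    also have "\<dots> \<le> measure M (?pre U - C) + measure M (C - ?pre V)"
      using pUC CpV by (rule measure_Un_le)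
    finally have "measure ?N (U - K) < e" using C(3) V by simp
    with VK show "\<exists>F. closedin Y F \<and> F \<subseteq> U \<and> measure ?N (U - F) < e" by blast
  qed
  ultimately show ?thesis
    using N unfolding P_tau_set_def by simp
qed

text \<open>For compact sets, in contrast to closed ones, images can be used for the approximation.\<close>

lemma distr_Radon_measure:
  assumes M: "M \<in> P_tau_set X" "Radon_measure X M" and f: "continuous_map X Y f"
    and Y: "Hausdorff_space Y"
  shows "Radon_measure Y (distr M (Borel_of Y) f)"
proof -
  note MD = P_tau_setD[OF M(1)]
  interpret prob_space M by (rule MD)
  let ?N = "distr M (Borel_of Y) f"
  have fm: "f \<in> measurable M (Borel_of Y)"
    using f MD(2) by (rule continuous_map_measurable_Borel_of)
  show ?thesis
    unfolding Radon_measure_def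
  proof (rule ballI, rule inner_approximation_SUP)
    show "finite_measure ?N"
      using prob_space_distr[OF fm] by (rule prob_space.finite_measure)
    fix B and e :: real assume B: "B \<in> sets ?N" and e: "e > 0"
    let ?S = "measure M ` {K. compactin X K \<and> K \<subseteq> f -` B \<inter> space M}"
    have pre: "f -` B \<inter> space M \<in> sets M" using fm B by (simp add: measurable_sets)
    have "measure ?N B = measure M (f -` B \<inter> space M)" using fm B by (simp add: measure_distr)
    also have "\<dots> = Sup ?S" using M(2) pre unfolding Radon_measure_def by blast
    finally have "measure ?N B - e < Sup ?S" using e by simp
    moreover have "{} \<in> {K. compactin X K \<and> K \<subseteq> f -` B \<inter> space M}" by simp
    then have "?S \<noteq> {}" by blast
    ultimately obtain s where "s \<in> ?S" "measure ?N B - e < s" by (meson less_cSupD)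
    then obtain K where K: "compactin X K" "K \<subseteq> f -` B \<inter> space M" "measure ?N B - e < measure M K" by auto
    have fK: "compactin Y (f ` K)" using K(1) f by (rule image_compactin)
    then have fKm: "f ` K \<in> sets (Borel_of Y)"
      using Y by (intro closedin_in_Borel_of compactin_imp_closedin)
    have "measure M K \<le> measure M (f -` (f ` K) \<inter> space M)"
      using K(2) fm fKm by (intro finite_measure_mono) (auto simp: measurable_sets)
    also have "\<dots> = measure ?N (f ` K)" using fm fKm by (simp add: measure_distr)
    finally show "\<exists>K\<in>{K. compactin Y K \<and> K \<subseteq> B}. measure ?N B < measure ?N K + e"
      using K(2,3) fK by (intro bexI[of _ "f ` K"]) auto
  qed simp_all
qed

section \<open>Test classes and the weak topology\<close>

definition bounded_continuous :: "'a topology \<Rightarrow> ('a \<Rightarrow> real) set" where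
  "bounded_continuous X = {f. continuous_map X euclideanreal f \<and> bounded (f ` topspace X)}"

text \<open>A class of functions rich enough to determine a \<open>\<tau>\<close>-smooth measure and the weak topology: scaled bumps
approximate every nonnegative lower semicontinuous function pointwise from below, and closure under
maxima makes the approximating functions an upward directed family, to which \<open>\<tau>\<close>-smoothness
applies.\<close>

definition test_class :: "'a topology \<Rightarrow> ('a \<Rightarrow> real) set \<Rightarrow> bool" where
  "test_class X \<G> \<longleftrightarrow>
     \<G> \<subseteq> bounded_continuous X \<and>
     (\<forall>g\<in>\<G>. \<forall>h\<in>\<G>. (\<lambda>x. max (g x) (h x)) \<in> \<G>) \<and>
     (\<forall>g\<in>\<G>. \<forall>c\<ge>0. (\<lambda>x. c * g x) \<in> \<G>) \<and>
     (\<forall>U x. openin X U \<longrightarrow> x \<in> U \<longrightarrow>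
        (\<exists>g\<in>\<G>. (\<forall>y\<in>topspace X. 0 \<le> g y \<and> g y \<le> 1) \<and> g x = 1 \<and> (\<forall>y\<in>topspace X - U. g y = 0)))"

lemma integrable_bounded_borel:
  fixes f :: "'a \<Rightarrow> real"
  assumes "finite_measure M" "f \<in> borel_measurable M" "\<And>x. x \<in> space M \<Longrightarrow> \<bar>f x\<bar> \<le> c"
  shows "integrable M f"
proof -
  interpret finite_measure M by fact
  show ?thesis
    by (rule integrable_const_bound[of _ c]) (use assms in auto)
qed

lemma integrable_bounded_continuous:
  assumes M: "M \<in> P_tau_set X" and f: "f \<in> bounded_continuous X"
  shows "integrable M f"
proof -
  from f obtain c where "\<And>x. x \<in> topspace X \<Longrightarrow> \<bar>f x\<bar> \<le> c"
    by (auto simp: bounded_continuous_def bounded_iff)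
  moreover have "f \<in> borel_measurable M"
    using f P_tau_setD(2)[OF M] by (auto simp: bounded_continuous_def intro: continuous_map_borel_measurable)
  ultimately show ?thesis
    using P_tau_setD(1,4)[OF M] by (intro integrable_bounded_borel) auto
qed

text \<open>A monotone convergence theorem for nets. The members \<open>g\<close> of the test class with \<open>0 \<le> g \<le> h\<close> have
pointwise supremum \<open>h\<close>, so the sets \<open>{x \<in> K. h x - g x \<ge> e}\<close> are closed, directed downwards and have
empty intersection, and one of them has measure below \<open>e\<close>. Outside it and inside \<open>K\<close> the error is at
most \<open>e\<close>; elsewhere it is at most \<open>c\<close>. The set \<open>K\<close> is there to treat at the same time continuous
functions and the indicators of open sets, which are continuous on a large closed set only.\<close>

lemma tau_smooth_lower_approximation:
  assumes M: "M \<in> P_tau_set X" and \<G>: "test_class X \<G>"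
    and K: "closedin X K" "measure M (topspace X - K) < e"
    and h: "h \<in> borel_measurable M" "continuous_map (subtopology X K) euclideanreal h"
      "\<And>a. openin X {x \<in> topspace X. a < h x}"
    and bound: "\<And>x. x \<in> topspace X \<Longrightarrow> 0 \<le> h x \<and> h x \<le> c"
    and e: "e > 0"
  obtains g where "g \<in> \<G>" "\<And>x. x \<in> topspace X \<Longrightarrow> 0 \<le> g x \<and> g x \<le> h x"
    "(\<integral>x. h x \<partial>M) \<le> (\<integral>x. g x \<partial>M) + e * (1 + 2 * c)"
proof -
  note MD = P_tau_setD[OF M]
  interpret prob_space M by (rule MD)
  obtain x0 where x0: "x0 \<in> topspace X" using not_empty unfolding MD(1) by blast
  with bound[of x0] have c: "c \<ge> 0" by linarith
  define \<D> where "\<D> = {g \<in> \<G>. \<forall>x\<in>topspace X. 0 \<le> g x \<and> g x \<le> h x}"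
  define F where "F g = {x \<in> K. e \<le> h x - g x}" for g :: "'a \<Rightarrow> real"
  have KX: "K \<subseteq> topspace X" using K(1) by (rule closedin_subset)
  have \<G>c: "continuous_map X euclideanreal g" if "g \<in> \<G>" for g
    using that \<G> by (auto simp: test_class_def bounded_continuous_def)
  have bump: "\<exists>g\<in>\<G>. (\<forall>y\<in>topspace X. 0 \<le> g y \<and> g y \<le> 1) \<and> g x = 1 \<and> (\<forall>y\<in>topspace X - U. g y = 0)"
    if "openin X U" "x \<in> U" for U x
    using \<G> that unfolding test_class_def by blast
  \<comment> \<open>A bump at \<open>x\<close> of height \<open>h x - e/2\<close>, supported where \<open>h\<close> exceeds that height.\<close>
  have near: "\<exists>g\<in>\<D>. h x - g x < e" if x: "x \<in> topspace X" for x
  proof -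
    define a where "a = max 0 (h x - e / 2)"
    let ?U = "{y \<in> topspace X. h x - e / 2 < h y}"
    obtain b where b: "b \<in> \<G>" "\<And>y. y \<in> topspace X \<Longrightarrow> 0 \<le> b y \<and> b y \<le> 1" "b x = 1"
      "\<And>y. y \<in> topspace X - ?U \<Longrightarrow> b y = 0"
      using bump[OF h(3)[of "h x - e / 2"], of x] x e by auto
    have "0 \<le> a * b y \<and> a * b y \<le> h y" if y: "y \<in> topspace X" for y
    proof (cases "y \<in> ?U")
      case True
      then have "a \<le> h y" using bound[OF y] by (auto simp: a_def)
      moreover have "a * b y \<le> a * 1" using b(2)[OF y] by (intro mult_left_mono) (auto simp: a_def)
      moreover have "0 \<le> a * b y" using b(2)[OF y] by (simp add: a_def)
      ultimately show ?thesis by linarith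
    next
      case False
      then show ?thesis using b(4)[of y] bound[OF y] y by simp
    qed
    moreover have "(\<lambda>y. a * b y) \<in> \<G>"
      using \<G> b(1) by (auto simp: test_class_def a_def)
    ultimately have "(\<lambda>y. a * b y) \<in> \<D>" by (simp add: \<D>_def)
    moreover have "h x - a * b x < e" using e b(3) by (simp add: a_def max_def)
    ultimately show ?thesis by (intro bexI[of _ "\<lambda>y. a * b y"])
  qed
  have "\<exists>A\<in>F ` \<D>. measure M A < e"
  proof (rule P_tau_set_directedD[OF M])
    show "F ` \<D> \<noteq> {}" using near[OF x0] by blast
    show "closedin X A" if "A \<in> F ` \<D>" for A
    proof -
      from that obtain g where g: "g \<in> \<G>" "A = F g" by (auto simp: \<D>_def)
      have "continuous_map (subtopology X K) euclideanreal (\<lambda>x. h x - g x)"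
        by (intro continuous_map_diff h(2) continuous_map_from_subtopology \<G>c g(1))
      then have "closedin (subtopology X K) {x \<in> topspace (subtopology X K). h x - g x \<in> {e..}}"
        by (rule closedin_continuous_map_preimage) simp
      also have "{x \<in> topspace (subtopology X K). h x - g x \<in> {e..}} = A"
        using KX by (auto simp: g(2) F_def)
      finally show ?thesis using K(1) by (simp add: closedin_closed_subtopology)
    qed
    show "\<exists>C\<in>F ` \<D>. C \<subseteq> A \<inter> B" if "A \<in> F ` \<D>" "B \<in> F ` \<D>" for A B
    proof -
      from that obtain g g' where g: "g \<in> \<D>" "g' \<in> \<D>" "A = F g" "B = F g'" by auto
      then have "(\<lambda>x. max (g x) (g' x)) \<in> \<D>"
        using \<G> by (auto simp: \<D>_def test_class_def le_max_iff_disj)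
      moreover have "F (\<lambda>x. max (g x) (g' x)) \<subseteq> A \<inter> B" by (auto simp: F_def g)
      ultimately show ?thesis by blast
    qed
    show "\<Inter> (F ` \<D>) = {}"
    proof (intro equals0I)
      fix x assume x: "x \<in> \<Inter> (F ` \<D>)"
      with near[OF x0] have "x \<in> K" by (auto simp: F_def)
      with KX near[of x] obtain g where "g \<in> \<D>" "h x - g x < e" by blast
      with x show False by (force simp: F_def)
    qed
  qed (rule e)
  then obtain g where g: "g \<in> \<D>" "measure M (F g) < e" by blast
  then have gh: "0 \<le> g x \<and> g x \<le> h x" if "x \<in> topspace X" for x
    using that by (auto simp: \<D>_def)
  have gG: "g \<in> \<G>" using g(1) by (simp add: \<D>_def)
  then have gi: "integrable M g"
    using \<G> M by (auto intro: integrable_bounded_continuous simp: test_class_def)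
  have hi: "integrable M h"
    using bound MD(1) by (intro integrable_bounded_borel[OF MD(4) h(1), of c]) (force simp: abs_if)
  have Km: "K \<in> sets M" using K(1) by (simp add: MD(2) closedin_in_Borel_of)
  note [measurable] = h(1) borel_measurable_integrable[OF gi]
  have "F g = {x \<in> space M. e \<le> h x - g x} \<inter> K" using KX by (auto simp: F_def MD(1))
  also have "\<dots> \<in> sets M" using Km by (intro sets.Int) measurable
  finally have Fm: "F g \<in> sets M" .
  have XKm: "topspace X - K \<in> sets M" using Km MD(1) by (metis sets.compl_sets)
  let ?r = "\<lambda>x. g x + e + c * indicator (F g) x + c * indicator (topspace X - K) x"
  have ii: "integrable M (\<lambda>x. c * indicator A x)" if "A \<in> sets M" for A
    using that by (intro integrable_mult_right integrable_real_indicator) (auto simp: emeasure_eq_measure)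
  have "(\<integral>x. h x \<partial>M) \<le> (\<integral>x. ?r x \<partial>M)"
  proof (rule integral_mono)
    show "integrable M ?r"
      using gi ii[OF Fm] ii[OF XKm] by (intro Bochner_Integration.integrable_add) auto
    fix x assume "x \<in> space M"
    then have x: "x \<in> topspace X" by (simp add: MD(1))
    show "h x \<le> ?r x"
      using bound[OF x] gh[OF x] c e x by (cases "x \<in> K") (auto simp: F_def indicator_def)
  qed (rule hi)
  also have "\<dots> = (\<integral>x. g x \<partial>M) + e + c * measure M (F g) + c * measure M (topspace X - K)"
    using gi ii[OF Fm] ii[OF XKm] Fm XKm sets.sets_into_space[OF Fm] sets.sets_into_space[OF XKm]
    by (simp add: prob_space Int_absorb2)
  also have "\<dots> \<le> (\<integral>x. g x \<partial>M) + e + c * e + c * e"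
    using g(2) K(2) c by (intro add_mono mult_left_mono) auto
  finally have "(\<integral>x. h x \<partial>M) \<le> (\<integral>x. g x \<partial>M) + e * (1 + 2 * c)"
    by (simp add: algebra_simps)
  with gG gh that show thesis by blast
qed

lemma continuous_lower_approximation:
  assumes M: "M \<in> P_tau_set X" and \<G>: "test_class X \<G>"
    and f: "continuous_map X euclideanreal f" "\<And>x. x \<in> topspace X \<Longrightarrow> 0 \<le> f x \<and> f x \<le> c"
    and e: "e > 0"
  obtains g where "g \<in> \<G>" "\<And>x. x \<in> topspace X \<Longrightarrow> g x \<le> f x"
    "(\<integral>x. f x \<partial>M) < (\<integral>x. g x \<partial>M) + e"
proof -
  interpret prob_space M by (rule P_tau_setD[OF M])
  obtain x0 where "x0 \<in> topspace X" using not_empty unfolding P_tau_setD(1)[OF M] by blast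
  with f(2)[of x0] have c: "c \<ge> 0" by linarith
  define d where "d = e / (2 * (1 + 2 * c))"
  have d: "d > 0" "d * (1 + 2 * c) = e / 2" using e c by (auto simp: d_def field_simps)
  have "openin X {x \<in> topspace X. a < f x}" for a
    using openin_continuous_map_preimage[OF f(1), of "{a<..}"] by simp
  then obtain g where "g \<in> \<G>" "\<And>x. x \<in> topspace X \<Longrightarrow> 0 \<le> g x \<and> g x \<le> f x"
    "(\<integral>x. f x \<partial>M) \<le> (\<integral>x. g x \<partial>M) + d * (1 + 2 * c)"
    using tau_smooth_lower_approximation[OF M \<G>, of "topspace X" d f c] f d(1)
      continuous_map_borel_measurable[OF f(1) P_tau_setD(2)[OF M]]
    by (auto simp: subtopology_topspace)
  with that d(2) e show thesis by force
qed

lemma open_lower_approximation: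
  assumes M: "M \<in> P_tau_set X" and \<G>: "test_class X \<G>" and U: "openin X U" and e: "e > 0"
  obtains g where "g \<in> \<G>" "\<And>x. x \<in> topspace X \<Longrightarrow> g x \<le> indicator U x"
    "measure M U \<le> (\<integral>x. g x \<partial>M) + e"
proof -
  note MD = P_tau_setD[OF M]
  interpret prob_space M by (rule MD)
  have Um: "U \<in> sets M" using U by (simp add: MD(2) openin_in_Borel_of)
  obtain C where C: "closedin X C" "C \<subseteq> U" "measure M (U - C) < e / 3"
    using regular_measureD[OF MD(4,2,5) Um, of "e / 3"] e by auto
  \<comment> \<open>On the closed set \<open>K\<close> the indicator of \<open>U\<close> is continuous, and \<open>K\<close> misses only \<open>U - C\<close>.\<close>
  define K where "K = C \<union> (topspace X - U)"
  have K: "closedin X K" using U C(1) by (auto simp: K_def)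
  have UX: "U \<subseteq> topspace X" and CX: "C \<subseteq> topspace X" using U C(1) openin_subset closedin_subset by blast+
  have "topspace X - K = U - C" using UX by (auto simp: K_def)
  with C have mK: "measure M (topspace X - K) < e / 3" by simp
  have ind: "continuous_map (subtopology X K) euclideanreal (indicator U)"
    unfolding continuous_map_def
  proof (intro conjI allI impI)
    fix W :: "real set"
    have "{x \<in> topspace (subtopology X K). indicator U x \<in> W} =
        (if 1 \<in> W then K \<inter> U else {}) \<union> (if 0 \<in> W then K \<inter> (topspace X - C) else {})"
      using UX CX C(2) by (auto simp: K_def indicator_def)
    moreover have "openin (subtopology X K) (K \<inter> U)" "openin (subtopology X K) (K \<inter> (topspace X - C))"
      using U C(1) by (auto intro: openin_subtopology_Int2)
    ultimately show "openin (subtopology X K) {x \<in> topspace (subtopology X K). indicator U x \<in> W}"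
      by (auto intro: openin_Un)
  qed auto
  have lsc: "openin X {x \<in> topspace X. a < indicator U x}" for a :: real
  proof -
    have "{x \<in> topspace X. a < indicator U x} = (if a < 0 then topspace X else if a < 1 then U else {})"
      using UX by (auto simp: indicator_def)
    with U show ?thesis by simp
  qed
  obtain g where g: "g \<in> \<G>" "\<And>x. x \<in> topspace X \<Longrightarrow> 0 \<le> g x \<and> g x \<le> indicator U x"
    "(\<integral>x. indicator U x \<partial>M) \<le> (\<integral>x. g x \<partial>M) + e / 3 * (1 + 2 * 1)"
    using Um e by (rule_tac tau_smooth_lower_approximation[OF M \<G> K mK _ ind lsc, of 1])
      (auto simp: indicator_def)
  have "(\<integral>x. indicator U x \<partial>M) = measure M U"
    using sets.sets_into_space[OF Um] by (simp add: Int_absorb2)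
  with g that show thesis by auto
qed

text \<open>Approximation from below of the indicators of open sets shows that the two measures agree on open sets,
which are stable under intersection and generate the Borel sets.\<close>

lemma P_tau_set_eqI:
  assumes M: "M \<in> P_tau_set X" and N: "N \<in> P_tau_set X" and \<G>: "test_class X \<G>"
    and eq: "\<And>g. g \<in> \<G> \<Longrightarrow> (\<integral>x. g x \<partial>M) = (\<integral>x. g x \<partial>N)"
  shows "M = N"
proof -
  have le: "measure M U \<le> measure N U"
    if M: "M \<in> P_tau_set X" and N: "N \<in> P_tau_set X" and U: "openin X U"
      and eq: "\<And>g. g \<in> \<G> \<Longrightarrow> (\<integral>x. g x \<partial>M) = (\<integral>x. g x \<partial>N)" for M N U
  proof (rule field_le_epsilon)
    fix e :: real assume "e > 0"
    then obtain g where g: "g \<in> \<G>" "\<And>x. x \<in> topspace X \<Longrightarrow> g x \<le> indicator U x"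
      "measure M U \<le> (\<integral>x. g x \<partial>M) + e"
      using open_lower_approximation[OF M \<G> U] by metis
    interpret N: prob_space N by (rule P_tau_setD[OF N])
    have Um: "U \<in> sets N" using U by (simp add: P_tau_setD(2)[OF N] openin_in_Borel_of)
    have "(\<integral>x. g x \<partial>N) \<le> (\<integral>x. indicator U x \<partial>N)"
      using g(1,2) \<G> Um P_tau_setD(1)[OF N]
      by (intro integral_mono integrable_bounded_continuous[OF N] integrable_real_indicator)
        (auto simp: test_class_def N.emeasure_eq_measure)
    also have "\<dots> = measure N U"
      using sets.sets_into_space[OF Um] by (simp add: Int_absorb2)
    finally show "measure M U \<le> measure N U + e"
      using g(3) eq[OF g(1)] by linarith
  qed
  interpret M: prob_space M by (rule P_tau_setD[OF M])
  interpret N: prob_space N by (rule P_tau_setD[OF N])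
  show ?thesis
  proof (rule measure_eqI_generator_eq)
    show "Int_stable {W. openin X W}" by (auto simp: Int_stable_def)
    show "{W. openin X W} \<subseteq> Pow (topspace X)" by (auto dest: openin_subset)
    show "sets M = sigma_sets (topspace X) {W. openin X W}"
      "sets N = sigma_sets (topspace X) {W. openin X W}"
      using P_tau_setD(2)[OF M] P_tau_setD(2)[OF N] by (simp_all add: sets_Borel_of)
    fix U assume "U \<in> {W. openin X W}"
    then have "measure M U = measure N U"
      using le[OF M N _ eq] le[OF N M _ eq[symmetric]] by (simp add: order_antisym)
    then show "emeasure M U = emeasure N U"
      by (simp add: M.emeasure_eq_measure N.emeasure_eq_measure)
  next
    show "range (\<lambda>_::nat. topspace X) \<subseteq> {W. openin X W}" by auto
  qed (auto simp: M.emeasure_eq_measure)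
qed

lemma continuous_map_integral_P_tau_top:
  assumes "f \<in> bounded_continuous X"
  shows "continuous_map (P_tau_top X) euclideanreal (\<lambda>M. \<integral>x. f x \<partial>M)"
  unfolding continuous_map_def topspace_P_tau_top
proof (intro conjI allI impI)
  fix W :: "real set" assume "openin euclideanreal W"
  then show "openin (P_tau_top X) {M \<in> P_tau_set X. (\<integral>x. f x \<partial>M) \<in> W}"
    using assms unfolding P_tau_top_def bounded_continuous_def
    by (intro topology_generated_by_Basis) auto
qed auto

text \<open>The heart of the argument: the weak topology, which is defined by all bounded continuous functions, is
already determined by the integrals of a test class. The integral of a test function below \<open>f\<close> is a
lower bound for the integral of \<open>f\<close> that is nearly attained at the given measure \<open>M\<close> and continuous in
the measure; shifting \<open>f\<close> and \<open>-f\<close> by a bound of \<open>f\<close> turns this into a two-sided estimate near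
\<open>M\<close>.\<close>

lemma initial_topology_P_tau_top:
  assumes \<G>: "test_class X \<G>"
  shows "initial_topology (P_tau_top X) ((\<lambda>g M. \<integral>x. g x \<partial>M) ` \<G>)"
  unfolding initial_topology_def topspace_P_tau_top
proof (intro conjI ballI allI impI)
  fix \<phi> assume "\<phi> \<in> (\<lambda>g M. \<integral>x. g x \<partial>M) ` \<G>"
  then show "continuous_map (P_tau_top X) euclideanreal \<phi>"
    using \<G> by (auto simp: test_class_def intro: continuous_map_integral_P_tau_top)
next
  let ?\<Phi> = "(\<lambda>g M. \<integral>x. g x \<partial>M) ` \<G>"
  let ?\<S> = "{{M \<in> P_tau_set X. (\<integral>x. f x \<partial>M) \<in> W} | f W.
        continuous_map X euclideanreal f \<and> bounded (f ` topspace X) \<and> open W}"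
  fix W M assume "openin (P_tau_top X) W" and "M \<in> W"
  then have "generate_topology_on ?\<S> W"
    unfolding P_tau_top_def by (simp add: openin_topology_generated_by)
  from this \<open>M \<in> W\<close>
  show "\<exists>A e. finite A \<and> A \<subseteq> ?\<Phi> \<and> e > 0 \<and>
      (\<forall>N\<in>P_tau_set X. (\<forall>\<phi>\<in>A. \<bar>\<phi> M - \<phi> N\<bar> < e) \<longrightarrow> N \<in> W)"
  proof (induction arbitrary: M)
    case Empty
    then show ?case by simp
  next
    case (Int a b)
    from Int.prems Int.IH(1)[of M] obtain A e where A: "finite A" "A \<subseteq> ?\<Phi>" "e > 0"
      "\<forall>N\<in>P_tau_set X. (\<forall>\<phi>\<in>A. \<bar>\<phi> M - \<phi> N\<bar> < e) \<longrightarrow> N \<in> a" by blast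
    from Int.prems Int.IH(2)[of M] obtain B d where B: "finite B" "B \<subseteq> ?\<Phi>" "d > 0"
      "\<forall>N\<in>P_tau_set X. (\<forall>\<phi>\<in>B. \<bar>\<phi> M - \<phi> N\<bar> < d) \<longrightarrow> N \<in> b" by blast
    from A B show ?case
      by (intro exI[of _ "A \<union> B"] exI[of _ "min e d"]) auto
  next
    case (UN \<K>)
    then obtain k where k: "k \<in> \<K>" "M \<in> k" by blast
    from UN.IH[OF k] obtain A e where "finite A" "A \<subseteq> ?\<Phi>" "e > 0"
      "\<forall>N\<in>P_tau_set X. (\<forall>\<phi>\<in>A. \<bar>\<phi> M - \<phi> N\<bar> < e) \<longrightarrow> N \<in> k" by blast
    with k(1) show ?case by (intro exI[of _ A] exI[of _ e]) auto
  next
    case (Basis s)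
    then obtain f V where s: "s = {M \<in> P_tau_set X. (\<integral>x. f x \<partial>M) \<in> V}"
      and f: "continuous_map X euclideanreal f" "bounded (f ` topspace X)" and V: "open V" by blast
    with Basis.prems have M: "M \<in> P_tau_set X" "(\<integral>x. f x \<partial>M) \<in> V" by auto
    with V obtain e where e: "e > 0" "ball (\<integral>x. f x \<partial>M) e \<subseteq> V" by (meson open_contains_ball)
    from f(2) obtain c where c: "\<And>x. x \<in> topspace X \<Longrightarrow> \<bar>f x\<bar> \<le> c" by (auto simp: bounded_iff)
    have fb: "f \<in> bounded_continuous X" using f by (simp add: bounded_continuous_def)
    \<comment> \<open>An approximation from below of \<open>c + f\<close> keeps the integral of \<open>f\<close> from dropping, one of
      \<open>c - f\<close> keeps it from rising.\<close>
    obtain g where g: "g \<in> \<G>" "\<And>x. x \<in> topspace X \<Longrightarrow> g x \<le> c + f x"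
      "(\<integral>x. c + f x \<partial>M) < (\<integral>x. g x \<partial>M) + e / 2"
    proof (rule continuous_lower_approximation[where e = "e / 2", OF M(1) \<G>])
      show "continuous_map X euclideanreal (\<lambda>x. c + f x)" by (intro continuous_map_add f) auto
      show "0 \<le> c + f x \<and> c + f x \<le> 2 * c" if "x \<in> topspace X" for x using c[OF that] by auto
    qed (use e in auto)
    obtain g' where g': "g' \<in> \<G>" "\<And>x. x \<in> topspace X \<Longrightarrow> g' x \<le> c - f x"
      "(\<integral>x. c - f x \<partial>M) < (\<integral>x. g' x \<partial>M) + e / 2"
    proof (rule continuous_lower_approximation[where e = "e / 2", OF M(1) \<G>])
      show "continuous_map X euclideanreal (\<lambda>x. c - f x)" by (intro continuous_map_diff f) auto
      show "0 \<le> c - f x \<and> c - f x \<le> 2 * c" if "x \<in> topspace X" for x using c[OF that] by auto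
    qed (use e in auto)
    have gb: "g \<in> bounded_continuous X" "g' \<in> bounded_continuous X"
      using \<G> g(1) g'(1) by (auto simp: test_class_def)
    have split: "(\<integral>x. c + f x \<partial>N) = c + (\<integral>x. f x \<partial>N)" "(\<integral>x. c - f x \<partial>N) = c - (\<integral>x. f x \<partial>N)"
      "(\<integral>x. g x \<partial>N) \<le> c + (\<integral>x. f x \<partial>N)" "(\<integral>x. g' x \<partial>N) \<le> c - (\<integral>x. f x \<partial>N)"
      if N: "N \<in> P_tau_set X" for N
    proof -
      interpret N: prob_space N by (rule P_tau_setD[OF N])
      note int = integrable_bounded_continuous[OF N]
      show p: "(\<integral>x. c + f x \<partial>N) = c + (\<integral>x. f x \<partial>N)" and m: "(\<integral>x. c - f x \<partial>N) = c - (\<integral>x. f x \<partial>N)"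
        using int[OF fb] by (simp_all add: N.prob_space)
      show "(\<integral>x. g x \<partial>N) \<le> c + (\<integral>x. f x \<partial>N)"
        unfolding p[symmetric] using int[OF fb] int[OF gb(1)] g(2) P_tau_setD(1)[OF N]
        by (intro integral_mono) auto
      show "(\<integral>x. g' x \<partial>N) \<le> c - (\<integral>x. f x \<partial>N)"
        unfolding m[symmetric] using int[OF fb] int[OF gb(2)] g'(2) P_tau_setD(1)[OF N]
        by (intro integral_mono) auto
    qed
    show ?case
    proof (intro exI[of _ "{\<lambda>M. \<integral>x. g x \<partial>M, \<lambda>M. \<integral>x. g' x \<partial>M}"] exI[of _ "e / 2"] conjI ballI impI)
      fix N assume N: "N \<in> P_tau_set X"
        and close: "\<forall>\<phi>\<in>{\<lambda>M. \<integral>x. g x \<partial>M, \<lambda>M. \<integral>x. g' x \<partial>M}. \<bar>\<phi> M - \<phi> N\<bar> < e / 2"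
      have "\<bar>(\<integral>x. g x \<partial>M) - (\<integral>x. g x \<partial>N)\<bar> < e / 2" "\<bar>(\<integral>x. g' x \<partial>M) - (\<integral>x. g' x \<partial>N)\<bar> < e / 2"
        using close by auto
      with g(3) g'(3) split[OF M(1)] split[OF N]
      have "\<bar>(\<integral>x. f x \<partial>M) - (\<integral>x. f x \<partial>N)\<bar> < e" by linarith
      with e(2) N show "N \<in> s" by (auto simp: s dist_real_def subset_eq)
    qed (use g(1) g'(1) e(1) in auto)
  qed
qed

lemma test_class_bounded_continuous:
  assumes "completely_regular_space X"
  shows "test_class X (bounded_continuous X)"
  unfolding test_class_def
proof (intro conjI ballI allI impI)
  fix g h assume g: "g \<in> bounded_continuous X" and h: "h \<in> bounded_continuous X"
  obtain a b where "\<And>x. x \<in> topspace X \<Longrightarrow> \<bar>g x\<bar> \<le> a" "\<And>x. x \<in> topspace X \<Longrightarrow> \<bar>h x\<bar> \<le> b"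
    using g h by (auto simp: bounded_continuous_def bounded_iff)
  then have "\<bar>max (g x) (h x)\<bar> \<le> max a b" if "x \<in> topspace X" for x
    using that by (fastforce simp: max_def)
  then have "bounded ((\<lambda>x. max (g x) (h x)) ` topspace X)" unfolding bounded_iff by auto
  then show "(\<lambda>x. max (g x) (h x)) \<in> bounded_continuous X"
    using g h by (auto simp: bounded_continuous_def intro: continuous_map_real_max)
next
  fix g and c :: real assume g: "g \<in> bounded_continuous X"
  then have "bounded ((\<lambda>x. c *\<^sub>R x) ` g ` topspace X)"
    by (intro bounded_scaling) (simp add: bounded_continuous_def)
  then show "(\<lambda>x. c * g x) \<in> bounded_continuous X"
    using g by (auto simp: bounded_continuous_def image_image intro: continuous_map_real_mult_left)
next
  fix U x assume U: "openin X U" and x: "x \<in> U"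
  have "closedin X (topspace X - U)" "x \<in> topspace X - (topspace X - U)"
    using U x openin_subset[OF U] by auto
  with assms obtain f :: "'a \<Rightarrow> real" where f: "continuous_map X (top_of_set {0..1}) f" "f x = 0"
      "f ` (topspace X - U) \<subseteq> {1}"
    unfolding completely_regular_space_def by meson
  have fc: "continuous_map X euclideanreal f" and f01: "\<And>y. y \<in> topspace X \<Longrightarrow> 0 \<le> f y \<and> f y \<le> 1"
    using f(1) by (auto simp: continuous_map_in_subtopology image_subset_iff)
  have "continuous_map X euclideanreal (\<lambda>y. 1 - f y)"
    by (intro continuous_map_diff fc) auto
  moreover have "bounded ((\<lambda>y. 1 - f y) ` topspace X)"
    unfolding bounded_iff using f01 by (intro exI[of _ 1]) auto
  ultimately have "(\<lambda>y. 1 - f y) \<in> bounded_continuous X" by (simp add: bounded_continuous_def)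
  then show "\<exists>g\<in>bounded_continuous X. (\<forall>y\<in>topspace X. 0 \<le> g y \<and> g y \<le> 1) \<and> g x = 1 \<and>
      (\<forall>y\<in>topspace X - U. g y = 0)"
    using f01 f(2,3) by (intro bexI[of _ "\<lambda>y. 1 - f y"]) auto
qed auto

section \<open>Uniformly continuous functions on a uniform space\<close>

text \<open>For a decreasing sequence \<open>E\<close> of entourages, a step in \<open>E n\<close> counts as having length \<open>2\<^sup>-\<^sup>n\<close>. The
infimum of the weights of the chains from \<open>x\<close> to \<open>y\<close> is the distance used in the classical proof that
a uniformity with a countable base is pseudometrizable.\<close>

fun chain :: "(nat \<Rightarrow> 'a \<times> 'a \<Rightarrow> bool) \<Rightarrow> nat list \<Rightarrow> 'a \<Rightarrow> 'a \<Rightarrow> bool" where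
  "chain E [] x y \<longleftrightarrow> x = y"
| "chain E (n # ns) x z \<longleftrightarrow> (\<exists>y. E n (x, y) \<and> chain E ns y z)"

definition weight :: "nat list \<Rightarrow> real" where
  "weight ns = (\<Sum>n\<leftarrow>ns. (1 / 2) ^ n)"

lemma chain_append: "chain E (ns @ ms) x z \<longleftrightarrow> (\<exists>y. chain E ns x y \<and> chain E ms y z)"
  by (induction ns arbitrary: x) auto

lemma weight_simps [simp]:
  "weight [] = 0" "weight (n # ns) = (1 / 2) ^ n + weight ns" "weight (ns @ ms) = weight ns + weight ms"
  by (simp_all add: weight_def)

lemma weight_nonneg: "weight ns \<ge> 0"
  by (induction ns) auto

lemma weight_split:
  assumes "0 \<le> t" "t < weight ns"
  shows "\<exists>as n bs. ns = as @ n # bs \<and> weight as \<le> t \<and> t < weight as + (1 / 2) ^ n"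
  using assms
proof (induction ns arbitrary: t)
  case (Cons n ns)
  show ?case
  proof (cases "t < (1 / 2) ^ n")
    case True
    with Cons.prems show ?thesis by (intro exI[of _ "[]"]) auto
  next
    case False
    with Cons.prems Cons.IH[of "t - (1 / 2) ^ n"] obtain as m bs where
      "ns = as @ m # bs" "weight as \<le> t - (1 / 2) ^ n" "t - (1 / 2) ^ n < weight as + (1 / 2) ^ m"
      by auto
    then show ?thesis
      by (intro exI[of _ "n # as"] exI[of _ m] exI[of _ bs]) auto
  qed
qed simp

text \<open>The chain is cut at the step that crosses half of its weight. The two remaining pieces weigh less
than half of \<open>2\<^sup>-\<^sup>m\<close>, so by induction each of them stays in \<open>E (m + 1)\<close>, and the crossing step is lighter than
\<open>2\<^sup>-\<^sup>m\<close>, so it lies in \<open>E (m + 1)\<close> too. Three consecutive steps in \<open>E (m + 1)\<close> compose to one in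
\<open>E m\<close>.\<close>

lemma light_chain:
  assumes refl: "\<And>n x. E n (x, x)"
    and triple: "\<And>n w x y z. E (Suc n) (w, x) \<Longrightarrow> E (Suc n) (x, y) \<Longrightarrow> E (Suc n) (y, z) \<Longrightarrow> E n (w, z)"
    and "chain E ns x y" "weight ns < (1 / 2) ^ m"
  shows "E m (x, y)"
  using assms(3,4)
proof (induction "length ns" arbitrary: ns m x y rule: less_induct)
  case less
  have dec: "E m (x, y)" if "m \<le> n" "E n (x, y)" for m n x y
    using that by (induction rule: dec_induct) (auto intro: triple refl)
  show ?case
  proof (cases "weight ns > 0")
    case False
    have "ns = []"
    proof (cases ns)
      case (Cons n ns')
      then have "weight ns > 0" using weight_nonneg[of ns'] by (simp add: add_pos_nonneg)
      with False show ?thesis by simp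
    qed
    with less.prems refl show ?thesis by simp
  next
    case True
    then obtain as n bs where ns: "ns = as @ n # bs"
      and as: "weight as \<le> weight ns / 2" "weight ns / 2 < weight as + (1 / 2) ^ n"
      using weight_split[of "weight ns / 2" ns] by auto
    have bs: "weight bs < weight ns / 2"
      using as(2) by (simp add: ns)
    obtain u v where uv: "chain E as x u" "E n (u, v)" "chain E bs v y"
      using less.prems(1) by (auto simp: ns chain_append)
    have "weight ns = weight as + ((1 / 2) ^ n + weight bs)" by (simp add: ns)
    then have "(1 / 2) ^ n < (1 / 2 :: real) ^ m"
      using less.prems(2) weight_nonneg[of as] weight_nonneg[of bs] by linarith
    then have "Suc m \<le> n" by simp
    then have "E (Suc m) (u, v)" using uv(2) by (rule dec)
    moreover have "E (Suc m) (x, u)"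
      by (rule less.hyps[OF _ uv(1)]) (use as(1) less.prems(2) in \<open>auto simp: ns\<close>)
    moreover have "E (Suc m) (v, y)"
      by (rule less.hyps[OF _ uv(3)]) (use bs less.prems(2) in \<open>auto simp: ns\<close>)
    ultimately show ?thesis by (rule_tac triple)
  qed
qed

definition bounded_uniformly_continuous :: "'a uspace \<Rightarrow> ('a \<Rightarrow> real) set" where
  "bounded_uniformly_continuous S = {g. bounded (g ` points S) \<and>
     (\<forall>e>0. eventually (\<lambda>(x, y). \<bar>g x - g y\<bar> < e) (entourages S))}"

text \<open>Uniform spaces are completely regular, even by uniformly continuous functions. Starting from an
entourage that keeps \<open>x\<close> within \<open>U\<close>, entourages are chosen so that three steps in one of them lie in the
previous one; the bump is \<open>1 - d\<close>, where \<open>d\<close> is the chain distance from \<open>x\<close> capped at \<open>1\<close>.\<close>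

lemma ex_uniform_bump:
  assumes S: "Hausdorff_uniform_space S" and U: "openin (uniform_topology S) U" and x: "x \<in> U"
  obtains g where "g \<in> bounded_uniformly_continuous S" "\<And>y. 0 \<le> g y \<and> g y \<le> 1" "g x = 1"
    "\<And>y. y \<notin> U \<Longrightarrow> g y = 0"
proof -
  define good where "good E \<longleftrightarrow> eventually E (entourages S) \<and> (\<forall>x. E (x, x)) \<and>
    (\<forall>x y. E (x, y) \<longrightarrow> E (y, x))" for E
  have sym: "eventually (\<lambda>(x, y). E (y, x)) (entourages S)" if "eventually E (entourages S)" for E
    using S that by (simp only: Hausdorff_uniform_space_def)
  have good_core: "good (\<lambda>(a, b). (E (a, b) \<and> E (b, a)) \<or> a = b)" if "eventually E (entourages S)" for E
  proof -
    have "eventually (\<lambda>(a, b). (E (a, b) \<and> E (b, a)) \<or> a = b) (entourages S)"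
      using that sym[OF that] by eventually_elim auto
    then show ?thesis by (auto simp: good_def)
  qed
  have half: "\<exists>D. good D \<and> (\<forall>x y z. D (x, y) \<longrightarrow> D (y, z) \<longrightarrow> E (x, z))" if E: "good E" for E
  proof -
    have "eventually E (entourages S)" using E by (simp add: good_def)
    then have "\<exists>D. eventually D (entourages S) \<and> (\<forall>x y z. D (x, y) \<longrightarrow> D (y, z) \<longrightarrow> E (x, z))"
      using S by (simp only: Hausdorff_uniform_space_def)
    then obtain D where D: "eventually D (entourages S)" "\<And>x y z. D (x, y) \<Longrightarrow> D (y, z) \<Longrightarrow> E (x, z)"
      by blast
    let ?D = "\<lambda>p. D p \<and> E p"
    have "eventually ?D (entourages S)"
      using D(1) E by (simp add: good_def eventually_conj)
    from good_core[OF this] D(2) E show ?thesis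
      by (intro exI[of _ "\<lambda>(a, b). (?D (a, b) \<and> ?D (b, a)) \<or> a = b"]) (auto simp: good_def)
  qed
  have third: "\<exists>D. good D \<and> (\<forall>w x y z. D (w, x) \<longrightarrow> D (x, y) \<longrightarrow> D (y, z) \<longrightarrow> E (w, z))"
    if E: "good E" for E
  proof -
    obtain D where D: "good D" "\<And>x y z. D (x, y) \<Longrightarrow> D (y, z) \<Longrightarrow> E (x, z)" using half[OF E] by blast
    obtain C where C: "good C" "\<And>x y z. C (x, y) \<Longrightarrow> C (y, z) \<Longrightarrow> D (x, z)" using half[OF D(1)] by blast
    have "E (w, z)" if "C (w, x)" "C (x, y)" "C (y, z)" for w x y z
      using D(2)[OF C(2)[OF that(1,2)] C(2)[OF that(3)]] C(1) by (simp add: good_def)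
    with C(1) show ?thesis by blast
  qed
  let ?V = "\<lambda>(x', y). x' = x \<longrightarrow> y \<in> U"
  have V: "eventually ?V (entourages S)"
    using U x unfolding openin_uniform_topology by blast
  \<comment> \<open>The diagonal is added because the entourages of the sequence must be reflexive on the whole type,
    not only on the points of \<open>S\<close>: chains may have arbitrary end points.\<close>
  define E0 where "E0 = (\<lambda>(a, b). (?V (a, b) \<and> ?V (b, a)) \<or> a = b)"
  have "\<exists>E. \<forall>n. (good (E n) \<and> (n = 0 \<longrightarrow> E n = E0)) \<and>
      (\<forall>w x y z. E (Suc n) (w, x) \<longrightarrow> E (Suc n) (x, y) \<longrightarrow> E (Suc n) (y, z) \<longrightarrow> E n (w, z))"
  proof (rule dependent_nat_choice)
    show "\<exists>E. good E \<and> (0 = (0::nat) \<longrightarrow> E = E0)"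
      unfolding E0_def using good_core[OF V] by blast
    fix E and n :: nat assume "good E \<and> (n = 0 \<longrightarrow> E = E0)"
    then show "\<exists>D. (good D \<and> (Suc n = 0 \<longrightarrow> D = E0)) \<and>
        (\<forall>w x y z. D (w, x) \<longrightarrow> D (x, y) \<longrightarrow> D (y, z) \<longrightarrow> E (w, z))"
      using third[of E] by auto
  qed
  then obtain E where E: "\<And>n. good (E n)" "E 0 = E0"
    and triple: "\<And>n w x y z. E (Suc n) (w, x) \<Longrightarrow> E (Suc n) (x, y) \<Longrightarrow> E (Suc n) (y, z) \<Longrightarrow> E n (w, z)"
    by blast
  have refl: "\<And>n x. E n (x, x)" and E_sym: "\<And>n x y. E n (x, y) \<Longrightarrow> E n (y, x)"
    using E(1) by (auto simp: good_def)
  \<comment> \<open>The member \<open>1\<close> is the cap; it also keeps the infimum meaningful for points that no chain from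
    \<open>x\<close> reaches.\<close>
  define A where "A y = insert 1 {weight ns | ns. chain E ns x y}" for y
  define d where "d y = Inf (A y)" for y
  have A_ne: "A y \<noteq> {}" and A_bdd: "bdd_below (A y)" for y
    by (auto simp: A_def intro!: bdd_belowI[of _ 0] weight_nonneg)
  have d_le: "d y \<le> a" if "a \<in> A y" for a y
    unfolding d_def using that A_bdd by (rule cInf_lower)
  have d_ge: "a \<le> d y" if "\<And>b. b \<in> A y \<Longrightarrow> a \<le> b" for a y
    unfolding d_def using A_ne that by (rule cInf_greatest)
  have d01: "0 \<le> d y \<and> d y \<le> 1" for y
    by (auto intro!: d_ge d_le simp: A_def weight_nonneg)
  have "chain E [] x x" by simp
  then have "weight [] \<in> A x" unfolding A_def by blast
  with d_le[of "weight []" x] d01[of x] have dx: "d x = 0" by simp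
  have d_off: "d y = 1" if y: "y \<notin> U" for y
  proof -
    have "1 \<le> weight ns" if "chain E ns x y" for ns
    proof (rule ccontr)
      assume "\<not> 1 \<le> weight ns"
      then have light: "weight ns < (1 / 2) ^ 0" by simp
      have "E 0 (x, y)"
        using refl triple that light by (rule light_chain)
      with y x show False by (auto simp: E(2) E0_def)
    qed
    then have "1 \<le> d y" by (intro d_ge) (auto simp: A_def)
    with d01[of y] show ?thesis by simp
  qed
  have step: "d z \<le> d y + (1 / 2) ^ n" if yz: "E n (y, z)" for n y z
  proof -
    have "d z - (1 / 2) ^ n \<le> d y"
    proof (rule d_ge)
      fix b assume "b \<in> A y"
      then consider "b = 1" | ns where "b = weight ns" "chain E ns x y" by (auto simp: A_def)
      then show "d z - (1 / 2) ^ n \<le> b"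
      proof cases
        case 1
        have "(0::real) \<le> (1 / 2) ^ n" by simp
        with 1 d01[of z] show ?thesis by linarith
      next
        case 2
        then have "chain E (ns @ [n]) x z" using yz by (auto simp: chain_append)
        then have "weight (ns @ [n]) \<in> A z" unfolding A_def by blast
        from d_le[OF this] 2(1) show ?thesis by simp
      qed
    qed
    then show ?thesis by linarith
  qed
  have "(\<lambda>y. 1 - d y) \<in> bounded_uniformly_continuous S"
    unfolding bounded_uniformly_continuous_def
  proof (intro CollectI conjI allI impI)
    show "bounded ((\<lambda>y. 1 - d y) ` points S)"
      unfolding bounded_iff using d01 by (intro exI[of _ 1]) auto
    fix e :: real assume "e > 0"
    then obtain n where n: "(1 / 2) ^ n < e" using real_arch_pow_inv[of e "1 / 2"] by auto
    have "eventually (E n) (entourages S)" using E(1) by (simp add: good_def)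
    then show "eventually (\<lambda>(y, z). \<bar>(1 - d y) - (1 - d z)\<bar> < e) (entourages S)"
    proof eventually_elim
      case (elim p)
      obtain y z where p: "p = (y, z)" by (cases p)
      with elim step[of n y z] step[of n z y] E_sym[of n y z] n show ?case by auto
    qed
  qed
  moreover have "0 \<le> 1 - d y \<and> 1 - d y \<le> 1" for y using d01[of y] by simp
  ultimately show thesis using dx d_off by (intro that[of "\<lambda>y. 1 - d y"]) auto
qed

lemma bounded_uniformly_continuous_subset:
  assumes S: "Hausdorff_uniform_space S"
  shows "bounded_uniformly_continuous S \<subseteq> bounded_continuous (uniform_topology S)"
proof
  fix g assume g: "g \<in> bounded_uniformly_continuous S"
  have "continuous_map (uniform_topology S) euclideanreal g"
    unfolding continuous_map_def topspace_uniform_topology[OF S] openin_uniform_topology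
  proof (intro conjI allI impI ballI)
    fix W :: "real set" and x assume W: "openin euclideanreal W" and x: "x \<in> {x \<in> points S. g x \<in> W}"
    then obtain e where e: "e > 0" "ball (g x) e \<subseteq> W"
      by (auto simp: open_contains_ball)
    have "eventually (\<lambda>p. p \<in> points S \<times> points S) (entourages S)"
      using S by (auto simp: Hausdorff_uniform_space_def le_principal)
    moreover have "eventually (\<lambda>(x, y). \<bar>g x - g y\<bar> < e) (entourages S)"
      using g e(1) by (simp add: bounded_uniformly_continuous_def)
    ultimately show "eventually (\<lambda>(x', y). x' = x \<longrightarrow> y \<in> {x \<in> points S. g x \<in> W}) (entourages S)"
      by eventually_elim (use e(2) in \<open>auto simp: dist_real_def subset_eq\<close>)
  qed auto
  with g show "g \<in> bounded_continuous (uniform_topology S)"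
    by (simp add: bounded_continuous_def bounded_uniformly_continuous_def topspace_uniform_topology[OF S])
qed

lemma test_class_bounded_uniformly_continuous:
  assumes S: "Hausdorff_uniform_space S"
  shows "test_class (uniform_topology S) (bounded_uniformly_continuous S)"
  unfolding test_class_def
proof (intro conjI ballI allI impI)
  fix g h assume g: "g \<in> bounded_uniformly_continuous S" and h: "h \<in> bounded_uniformly_continuous S"
  obtain a where a: "\<forall>x\<in>points S. \<bar>g x\<bar> \<le> a"
    using g by (auto simp: bounded_uniformly_continuous_def bounded_iff)
  obtain b where b: "\<forall>x\<in>points S. \<bar>h x\<bar> \<le> b"
    using h by (auto simp: bounded_uniformly_continuous_def bounded_iff)
  from a b have "\<bar>max (g x) (h x)\<bar> \<le> max a b" if "x \<in> points S" for x
    using that by (fastforce simp: max_def)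
  then have "bounded ((\<lambda>x. max (g x) (h x)) ` points S)" unfolding bounded_iff by auto
  moreover have "eventually (\<lambda>(x, y). \<bar>max (g x) (h x) - max (g y) (h y)\<bar> < e) (entourages S)"
    if e: "e > 0" for e
  proof -
    have "eventually (\<lambda>(x, y). \<bar>g x - g y\<bar> < e) (entourages S)"
      "eventually (\<lambda>(x, y). \<bar>h x - h y\<bar> < e) (entourages S)"
      using g h e by (auto simp: bounded_uniformly_continuous_def)
    then show ?thesis by eventually_elim (auto simp: max_def abs_if split: if_splits)
  qed
  ultimately show "(\<lambda>x. max (g x) (h x)) \<in> bounded_uniformly_continuous S"
    by (simp add: bounded_uniformly_continuous_def)
next
  fix g and c :: real assume g: "g \<in> bounded_uniformly_continuous S" and c: "c \<ge> 0"
  have "bounded ((\<lambda>x. c *\<^sub>R x) ` g ` points S)"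
    using g by (intro bounded_scaling) (simp add: bounded_uniformly_continuous_def)
  moreover have "eventually (\<lambda>(x, y). \<bar>c * g x - c * g y\<bar> < e) (entourages S)" if e: "e > 0" for e
  proof -
    have "e / (c + 1) > 0" using e c by simp
    then have "eventually (\<lambda>(x, y). \<bar>g x - g y\<bar> < e / (c + 1)) (entourages S)"
      using g unfolding bounded_uniformly_continuous_def by blast
    then show ?thesis
    proof eventually_elim
      case (elim p)
      obtain x y where p: "p = (x, y)" by (cases p)
      have "\<bar>c * g x - c * g y\<bar> = c * \<bar>g x - g y\<bar>"
        using c by (simp add: abs_mult flip: right_diff_distrib)
      also have "\<dots> \<le> (c + 1) * \<bar>g x - g y\<bar>" by (intro mult_right_mono) auto
      also have "\<dots> < (c + 1) * (e / (c + 1))"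
        using elim c by (intro mult_strict_left_mono) (auto simp: p)
      finally show ?case using c by (simp add: p)
    qed
  qed
  ultimately show "(\<lambda>x. c * g x) \<in> bounded_uniformly_continuous S"
    by (simp add: bounded_uniformly_continuous_def image_image)
next
  fix U x assume "openin (uniform_topology S) U" "x \<in> U"
  from ex_uniform_bump[OF S this] obtain g where "g \<in> bounded_uniformly_continuous S"
    "\<And>y. 0 \<le> g y \<and> g y \<le> 1" "g x = 1" "\<And>y. y \<notin> U \<Longrightarrow> g y = 0" by metis
  then show "\<exists>g\<in>bounded_uniformly_continuous S.
      (\<forall>y\<in>topspace (uniform_topology S). 0 \<le> g y \<and> g y \<le> 1) \<and> g x = 1 \<and>
      (\<forall>y\<in>topspace (uniform_topology S) - U. g y = 0)" by auto
qed (rule bounded_uniformly_continuous_subset[OF S])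

text \<open>By the bumps, the topology of a uniform space is the initial one for its bounded uniformly continuous
functions.\<close>

lemma Tychonoff_uniform_topology:
  assumes S: "Hausdorff_uniform_space S"
  shows "Tychonoff_space (uniform_topology S)"
proof (rule Tychonoff_initial_topology)
  let ?X = "uniform_topology S"
  show "initial_topology ?X (bounded_uniformly_continuous S)"
    unfolding initial_topology_def
  proof (intro conjI ballI allI impI)
    show "continuous_map ?X euclideanreal g" if "g \<in> bounded_uniformly_continuous S" for g
      using that bounded_uniformly_continuous_subset[OF S] by (auto simp: bounded_continuous_def)
    fix W x assume W: "openin ?X W" "x \<in> W"
    from ex_uniform_bump[OF S this] obtain g where g: "g \<in> bounded_uniformly_continuous S"
      "g x = 1" "\<And>y. y \<notin> W \<Longrightarrow> g y = 0" by metis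
    then show "\<exists>A e. finite A \<and> A \<subseteq> bounded_uniformly_continuous S \<and> 0 < e \<and>
        (\<forall>y\<in>topspace ?X. (\<forall>\<phi>\<in>A. \<bar>\<phi> x - \<phi> y\<bar> < e) \<longrightarrow> y \<in> W)"
      by (intro exI[of _ "{g}"] exI[of _ 1]) force
  qed
  fix x y assume xy: "x \<in> topspace ?X" "y \<in> topspace ?X"
    and eq: "\<And>g. g \<in> bounded_uniformly_continuous S \<Longrightarrow> g x = g y"
  show "x = y"
  proof (rule ccontr)
    assume "x \<noteq> y"
    have "openin ?X (points S - {y})"
      unfolding openin_uniform_topology
    proof (intro conjI ballI)
      fix z assume "z \<in> points S - {y}"
      then obtain E where E: "eventually E (entourages S)" "\<not> E (z, y)"
        using S xy(2) unfolding Hausdorff_uniform_space_def topspace_uniform_topology[OF S] by blast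
      have "eventually (\<lambda>p. p \<in> points S \<times> points S) (entourages S)"
        using S by (auto simp: Hausdorff_uniform_space_def le_principal)
      with E(1) show "eventually (\<lambda>(x', w). x' = z \<longrightarrow> w \<in> points S - {y}) (entourages S)"
        by eventually_elim (use E(2) in auto)
    qed auto
    moreover have "x \<in> points S - {y}"
      using xy(1) \<open>x \<noteq> y\<close> by (simp add: topspace_uniform_topology[OF S])
    ultimately obtain g where "g \<in> bounded_uniformly_continuous S" "g x = 1"
      "\<And>w. w \<notin> points S - {y} \<Longrightarrow> g w = 0"
      using ex_uniform_bump[OF S] by metis
    with eq[of g] show False by simp
  qed
qed

lemma uniformly_continuous_map_imp_continuous_map:
  assumes S: "Hausdorff_uniform_space S" and T: "Hausdorff_uniform_space T"
    and f: "uniformly_continuous_map S T f"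
  shows "continuous_map (uniform_topology S) (uniform_topology T) f"
  unfolding continuous_map_def topspace_uniform_topology[OF S] topspace_uniform_topology[OF T]
proof (intro conjI allI impI)
  show fST: "f \<in> points S \<rightarrow> points T" using f by (simp add: uniformly_continuous_map_def)
  fix W assume W: "openin (uniform_topology T) W"
  show "openin (uniform_topology S) {x \<in> points S. f x \<in> W}"
    unfolding openin_uniform_topology
  proof (intro conjI ballI)
    fix x assume x: "x \<in> {x \<in> points S. f x \<in> W}"
    then have "eventually (\<lambda>(x', y). x' = f x \<longrightarrow> y \<in> W) (entourages T)"
      using W by (auto simp: openin_uniform_topology)
    then have "eventually (\<lambda>p. case (case p of (x, y) \<Rightarrow> (f x, f y)) of (x', y) \<Rightarrow> x' = f x \<longrightarrow> y \<in> W)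
        (entourages S)"
      using f unfolding uniformly_continuous_map_def filterlim_iff by blast
    moreover have "eventually (\<lambda>p. p \<in> points S \<times> points S) (entourages S)"
      using S by (auto simp: Hausdorff_uniform_space_def le_principal)
    ultimately show "eventually (\<lambda>(x', y). x' = x \<longrightarrow> y \<in> {x \<in> points S. f x \<in> W}) (entourages S)"
      by eventually_elim auto
  qed auto
qed

lemma bounded_uniformly_continuous_compose:
  assumes f: "uniformly_continuous_map S T f" and g: "g \<in> bounded_uniformly_continuous T"
  shows "(\<lambda>x. g (f x)) \<in> bounded_uniformly_continuous S"
  unfolding bounded_uniformly_continuous_def
proof (intro CollectI conjI allI impI)
  have "(\<lambda>x. g (f x)) ` points S \<subseteq> g ` points T"
    using f by (auto simp: uniformly_continuous_map_def)
  then show "bounded ((\<lambda>x. g (f x)) ` points S)"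
    using g bounded_subset by (auto simp: bounded_uniformly_continuous_def)
  fix e :: real assume "e > 0"
  then have "eventually (\<lambda>(x, y). \<bar>g x - g y\<bar> < e) (entourages T)"
    using g by (simp add: bounded_uniformly_continuous_def)
  with f show "eventually (\<lambda>(x, y). \<bar>g (f x) - g (f y)\<bar> < e) (entourages S)"
    unfolding uniformly_continuous_map_def filterlim_iff by (fastforce simp: case_prod_unfold)
qed

section \<open>The functors and their lifts\<close>

text \<open>The predicate \<open>R\<close> allows both functors to be treated at once: it is trivial for \<^const>\<open>P_tau\<close> and the
Radon property for \<^const>\<open>P_hat\<close>.\<close>

definition measure_subspace :: "('a topology \<Rightarrow> 'a measure \<Rightarrow> bool) \<Rightarrow> 'a topology \<Rightarrow> 'a measure topology" where
  "measure_subspace R X = subtopology (P_tau_top X) {M \<in> P_tau_set X. R X M}"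

definition measure_functor ::
  "('a topology \<Rightarrow> 'a measure \<Rightarrow> bool) \<Rightarrow>
     ('a topology, 'a \<Rightarrow> 'a, 'a measure topology, 'a measure \<Rightarrow> 'a measure) fctr" where
  "measure_functor R = \<lparr> on_obj = measure_subspace R,
     on_hom = (\<lambda>X Y f. \<lambda>M\<in>topspace (measure_subspace R X). distr M (Borel_of Y) f) \<rparr>"

lemma P_tau_eq_measure_functor:
  "P_tau = measure_functor (\<lambda>(_ :: 'a topology) (_ :: 'a measure). True)"
proof -
  have "measure_subspace (\<lambda>_ _. True) = (P_tau_top :: 'a topology \<Rightarrow> _)"
    by (rule ext) (simp add: measure_subspace_def subtopology_topspace flip: topspace_P_tau_top)
  then show ?thesis by (simp add: P_tau_def measure_functor_def)
qed

lemma P_hat_eq_measure_functor: "P_hat = measure_functor Radon_measure"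
  unfolding P_hat_def measure_functor_def measure_subspace_def[abs_def] P_hat_top_def[abs_def] ..

definition pushforward_stable :: "('a topology \<Rightarrow> 'a measure \<Rightarrow> bool) \<Rightarrow> bool" where
  "pushforward_stable R \<longleftrightarrow> (\<forall>X Y f M. Tychonoff_space X \<longrightarrow> Tychonoff_space Y \<longrightarrow>
     continuous_map X Y f \<longrightarrow> M \<in> P_tau_set X \<longrightarrow> R X M \<longrightarrow> R Y (distr M (Borel_of Y) f))"

lemma topspace_measure_subspace: "topspace (measure_subspace R X) = {M \<in> P_tau_set X. R X M}"
  by (auto simp: measure_subspace_def topspace_P_tau_top)

lemma distr_in_measure_subspace:
  assumes "pushforward_stable R" "Tychonoff_space X" "Tychonoff_space Y" "continuous_map X Y f"
    and "M \<in> topspace (measure_subspace R X)"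
  shows "distr M (Borel_of Y) f \<in> topspace (measure_subspace R Y)"
  using assms distr_in_P_tau_set[of M X Y f] completely_regular_imp_regular_space[of Y]
  by (auto simp: topspace_measure_subspace pushforward_stable_def Tychonoff_space_def)

abbreviation integrals :: "('a \<Rightarrow> real) set \<Rightarrow> ('a measure \<Rightarrow> real) set" where
  "integrals \<G> \<equiv> (\<lambda>g M. \<integral>x. g x \<partial>M) ` \<G>"

lemma integrals_separate:
  assumes "test_class X \<G>" "M \<in> topspace (measure_subspace R X)" "N \<in> topspace (measure_subspace R X)"
    and "\<And>\<phi>. \<phi> \<in> integrals \<G> \<Longrightarrow> \<phi> M = \<phi> N"
  shows "M = N"
  using assms by (intro P_tau_set_eqI[of M X N \<G>]) (auto simp: topspace_measure_subspace)

lemma initial_topology_measure_subspace: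
  assumes "test_class X \<G>"
  shows "initial_topology (measure_subspace R X) (integrals \<G>)"
  unfolding measure_subspace_def by (intro initial_topology_subtopology initial_topology_P_tau_top assms)

lemma Tychonoff_measure_subspace:
  assumes "Tychonoff_space X"
  shows "Tychonoff_space (measure_subspace R X)"
proof -
  have test: "test_class X (bounded_continuous X)"
    using assms by (simp add: Tychonoff_space_def test_class_bounded_continuous)
  show ?thesis
    by (rule Tychonoff_initial_topology[OF initial_topology_measure_subspace[OF test]
        integrals_separate[OF test]])
qed

text \<open>Integrating \<open>h\<close> against the push-forward along \<open>f\<close> is integrating \<open>h \<circ> f\<close> against the original measure,
so push-forward pulls generators back to generators. With all bounded continuous functions this
yields continuity of the push-forward, with the uniformly continuous ones its uniform continuity.\<close>

lemma uniformly_continuous_pushforward: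
  assumes R: "pushforward_stable R" and X: "Tychonoff_space X" and Y: "Tychonoff_space Y"
    and f: "continuous_map X Y f"
    and \<H>: "\<H> \<subseteq> bounded_continuous Y" "\<And>h. h \<in> \<H> \<Longrightarrow> (\<lambda>x. h (f x)) \<in> \<G>"
  shows "uniformly_continuous_map
    (initial_uniformity (topspace (measure_subspace R X)) (integrals \<G>))
    (initial_uniformity (topspace (measure_subspace R Y)) (integrals \<H>))
    (on_hom (measure_functor R) X Y f)"
proof (rule uniformly_continuous_map_initial_uniformity)
  show "on_hom (measure_functor R) X Y f \<in> topspace (measure_subspace R X) \<rightarrow> topspace (measure_subspace R Y)"
    using distr_in_measure_subspace[OF R X Y f] by (simp add: measure_functor_def)
  fix \<phi> assume "\<phi> \<in> integrals \<H>"
  then obtain h where h: "h \<in> \<H>" "\<phi> = (\<lambda>M. \<integral>x. h x \<partial>M)" by auto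
  have "\<phi> (on_hom (measure_functor R) X Y f M) = (\<integral>x. h (f x) \<partial>M)"
    if M: "M \<in> topspace (measure_subspace R X)" for M
  proof -
    have "sets M = sets (Borel_of X)" using M by (auto simp: topspace_measure_subspace P_tau_setD(2))
    then have "f \<in> measurable M (Borel_of Y)" by (rule continuous_map_measurable_Borel_of[OF f])
    moreover have "h \<in> borel_measurable (Borel_of Y)"
      using h(1) \<H>(1) by (intro continuous_map_borel_measurable[of Y]) (auto simp: bounded_continuous_def)
    ultimately show ?thesis
      using M by (simp add: h(2) measure_functor_def integral_distr)
  qed
  then show "\<exists>\<psi>\<in>integrals \<G>. \<forall>M\<in>topspace (measure_subspace R X). \<phi> (on_hom (measure_functor R) X Y f M) = \<psi> M"
    using \<H>(2)[OF h(1)] by (intro bexI[of _ "\<lambda>M. \<integral>x. h (f x) \<partial>M"]) auto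
qed

lemma continuous_pushforward:
  assumes R: "pushforward_stable R" and X: "Tychonoff_space X" and Y: "Tychonoff_space Y"
    and f: "continuous_map X Y f"
  shows "continuous_map (measure_subspace R X) (measure_subspace R Y) (on_hom (measure_functor R) X Y f)"
proof -
  let ?C = bounded_continuous
  let ?U = "\<lambda>X. initial_uniformity (topspace (measure_subspace R X)) (integrals (?C X))"
  have test: "test_class Z (?C Z)" if "Tychonoff_space Z" for Z :: "'a topology"
    using that by (simp add: Tychonoff_space_def test_class_bounded_continuous)
  have top: "uniform_topology (?U Z) = measure_subspace R Z" if "Tychonoff_space Z" for Z
    by (intro uniform_topology_initial_uniformity initial_topology_measure_subspace test that)
  have Haus: "Hausdorff_uniform_space (?U Z)" if "Tychonoff_space Z" for Z
    by (rule Hausdorff_initial_uniformity) (rule integrals_separate[OF test[OF that]])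
  have "(\<lambda>x. h (f x)) \<in> ?C X" if "h \<in> ?C Y" for h
  proof -
    have "(\<lambda>x. h (f x)) ` topspace X \<subseteq> h ` topspace Y"
      using f by (auto simp: continuous_map_def)
    with that show ?thesis
      using continuous_map_compose[OF f, of euclideanreal h] bounded_subset
      by (auto simp: bounded_continuous_def o_def)
  qed
  then have "uniformly_continuous_map (?U X) (?U Y) (on_hom (measure_functor R) X Y f)"
    by (intro uniformly_continuous_pushforward[OF R X Y f]) auto
  from uniformly_continuous_map_imp_continuous_map[OF Haus[OF X] Haus[OF Y] this]
  show ?thesis by (simp add: top X Y)
qed

lemma is_functor_measure_functor:
  assumes R: "pushforward_stable R"
  shows "is_functor Tych Tych (measure_functor R)"
  unfolding is_functor_def Tych_def cat.select_convs mem_Collect_eq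
proof (intro conjI ballI; (elim CollectE conjE)?)
  have sp: "space M = topspace X" "sets M = sets (Borel_of X)"
    if "M \<in> topspace (measure_subspace R X)" for M X
    using that by (auto simp: topspace_measure_subspace P_tau_setD(1,2))
  fix X Y Z :: "'a topology" and f g :: "'a \<Rightarrow> 'a"
  show "Tychonoff_space (on_obj (measure_functor R) X)" if "Tychonoff_space X"
    using that by (simp add: measure_functor_def Tychonoff_measure_subspace)
  show "on_hom (measure_functor R) X Y f \<in> extensional (topspace (on_obj (measure_functor R) X))"
    by (simp add: measure_functor_def)
  show "continuous_map (on_obj (measure_functor R) X) (on_obj (measure_functor R) Y)
      (on_hom (measure_functor R) X Y f)"
    if "Tychonoff_space X" "Tychonoff_space Y"
      "f \<in> extensional (topspace X)" "continuous_map X Y f"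
    using continuous_pushforward[OF R _ _ that(4)] that(1,2) by (simp add: measure_functor_def)
  show "on_hom (measure_functor R) X X (\<lambda>x\<in>topspace X. x) =
      (\<lambda>x\<in>topspace (on_obj (measure_functor R) X). x)" if "Tychonoff_space X"
  proof -
    have "distr M (Borel_of X) (\<lambda>x\<in>topspace X. x) = M" if M: "M \<in> topspace (measure_subspace R X)" for M
    proof -
      have "distr M (Borel_of X) (\<lambda>x\<in>topspace X. x) = distr M (Borel_of X) (\<lambda>x. x)"
        using sp[OF M] by (intro distr_cong) auto
      also have "\<dots> = M" using sp(2)[OF M] by (intro distr_id2) simp
      finally show ?thesis .
    qed
    then show ?thesis by (auto simp: measure_functor_def intro!: restrict_ext)
  qed
  show "on_hom (measure_functor R) X Z (compose (topspace X) g f) =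
      compose (topspace (on_obj (measure_functor R) X))
        (on_hom (measure_functor R) Y Z g) (on_hom (measure_functor R) X Y f)"
    if X: "Tychonoff_space X" and Y: "Tychonoff_space Y"
      and f: "continuous_map X Y f" and g: "continuous_map Y Z g"
  proof -
    have "distr M (Borel_of Z) (compose (topspace X) g f) = distr (distr M (Borel_of Y) f) (Borel_of Z) g"
      if M: "M \<in> topspace (measure_subspace R X)" for M
    proof -
      have "distr (distr M (Borel_of Y) f) (Borel_of Z) g = distr M (Borel_of Z) (g \<circ> f)"
        using continuous_map_measurable_Borel_of[OF g refl] continuous_map_measurable_Borel_of[OF f sp(2)[OF M]]
        by (rule distr_distr)
      also have "\<dots> = distr M (Borel_of Z) (compose (topspace X) g f)"
        using sp(1)[OF M] by (intro distr_cong) (auto simp: compose_def)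
      finally show ?thesis by simp
    qed
    moreover have "distr M (Borel_of Y) f \<in> topspace (measure_subspace R Y)"
      if "M \<in> topspace (measure_subspace R X)" for M
      using distr_in_measure_subspace[OF R _ _ f that] X Y by simp
    ultimately show ?thesis
      by (auto simp: measure_functor_def compose_def intro!: restrict_ext)
  qed
qed

definition uniform_measure_functor ::
  "('a topology \<Rightarrow> 'a measure \<Rightarrow> bool) \<Rightarrow>
     ('a uspace, 'a \<Rightarrow> 'a, 'a measure uspace, 'a measure \<Rightarrow> 'a measure) fctr" where
  "uniform_measure_functor R =
     \<lparr> on_obj = (\<lambda>S. initial_uniformity (topspace (measure_subspace R (uniform_topology S)))
         (integrals (bounded_uniformly_continuous S))),
       on_hom = (\<lambda>S T. on_hom (measure_functor R) (uniform_topology S) (uniform_topology T)) \<rparr>"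

text \<open>The functor laws only concern the underlying maps, and these are the maps that the functor on
Tychonoff spaces assigns to the induced topologies.\<close>

lemma is_functor_uniform_measure_functor:
  assumes R: "pushforward_stable R"
  shows "is_functor Unif Unif (uniform_measure_functor R)"
proof -
  let ?F = "uniform_measure_functor R" and ?G = "measure_functor R"
  have G: "is_functor Tych Tych ?G" using R by (rule is_functor_measure_functor)
  have obj: "uniform_topology S \<in> Obj Tych" if "Hausdorff_uniform_space S" for S :: "'a uspace"
    using that by (simp add: Tych_def Tychonoff_uniform_topology)
  have hom: "f \<in> Hom Tych (uniform_topology S) (uniform_topology T)"
    if "Hausdorff_uniform_space S" "Hausdorff_uniform_space T" "f \<in> extensional (points S)"
      "uniformly_continuous_map S T f" for S T :: "'a uspace" and f
    using that by (simp add: Tych_def topspace_uniform_topology uniformly_continuous_map_imp_continuous_map)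
  have pts: "points (on_obj ?F S) = topspace (on_obj ?G (uniform_topology S))" for S
    by (simp add: uniform_measure_functor_def measure_functor_def)
  show ?thesis
    unfolding is_functor_def Unif_def cat.select_convs mem_Collect_eq
  proof (intro conjI ballI; (elim CollectE conjE)?)
    fix S T V :: "'a uspace" and f g :: "'a \<Rightarrow> 'a"
    show "Hausdorff_uniform_space (on_obj ?F S)" if S: "Hausdorff_uniform_space S"
      unfolding uniform_measure_functor_def fctr.select_convs
      by (rule Hausdorff_initial_uniformity)
        (rule integrals_separate[OF test_class_bounded_uniformly_continuous[OF S]])
    show "on_hom ?F S T f \<in> extensional (points (on_obj ?F S))"
      by (simp add: uniform_measure_functor_def measure_functor_def)
    show "uniformly_continuous_map (on_obj ?F S) (on_obj ?F T) (on_hom ?F S T f)"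
      if S: "Hausdorff_uniform_space S" and T: "Hausdorff_uniform_space T"
        and f: "uniformly_continuous_map S T f"
      unfolding uniform_measure_functor_def fctr.select_convs
      by (rule uniformly_continuous_pushforward[OF R Tychonoff_uniform_topology[OF S]
          Tychonoff_uniform_topology[OF T] uniformly_continuous_map_imp_continuous_map[OF S T f]
          bounded_uniformly_continuous_subset[OF T] bounded_uniformly_continuous_compose[OF f]])
    show "on_hom ?F S S (\<lambda>x\<in>points S. x) = (\<lambda>x\<in>points (on_obj ?F S). x)"
      if "Hausdorff_uniform_space S"
    proof -
      have S: "Hausdorff_uniform_space S" using that by simp
      have "on_hom ?G (uniform_topology S) (uniform_topology S) (Ident Tych (uniform_topology S)) =
          Ident Tych (on_obj ?G (uniform_topology S))"
        using G obj[OF S] by (simp add: is_functor_def)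
      then show ?thesis
        unfolding pts by (simp add: Tych_def topspace_uniform_topology[OF S] uniform_measure_functor_def)
    qed
    show "on_hom ?F S V (compose (points S) g f) =
        compose (points (on_obj ?F S)) (on_hom ?F T V g) (on_hom ?F S T f)"
      if "Hausdorff_uniform_space S" "Hausdorff_uniform_space T"
        "Hausdorff_uniform_space V" "f \<in> extensional (points S)" "uniformly_continuous_map S T f"
        "g \<in> extensional (points T)" "uniformly_continuous_map T V g"
    proof -
      let ?S = "uniform_topology S" and ?T = "uniform_topology T" and ?V = "uniform_topology V"
      have S: "Hausdorff_uniform_space S" and T: "Hausdorff_uniform_space T"
        and V: "Hausdorff_uniform_space V" using that by auto
      have "on_hom ?G ?S ?V (Comp Tych ?S ?T ?V g f) =
          Comp Tych (on_obj ?G ?S) (on_obj ?G ?T) (on_obj ?G ?V) (on_hom ?G ?T ?V g) (on_hom ?G ?S ?T f)"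
        using G obj[OF S] obj[OF T] obj[OF V] hom[OF S T that(4,5)] hom[OF T V that(6,7)]
        by (simp add: is_functor_def)
      then show ?thesis
        unfolding pts by (simp add: Tych_def topspace_uniform_topology[OF S] uniform_measure_functor_def)
    qed
  qed
qed

text \<open>On objects this is the agreement of two initial topologies: for bounded uniformly continuous and for
bounded continuous functions.\<close>

lemma uniform_measure_functor_lifts:
  "functors_eq Unif (U_forget \<circ>\<^sub>F uniform_measure_functor R) (measure_functor R \<circ>\<^sub>F U_forget)"
proof -
  have "uniform_topology (on_obj (uniform_measure_functor R) S) = measure_subspace R (uniform_topology S)"
    if "Hausdorff_uniform_space S" for S
    unfolding uniform_measure_functor_def fctr.select_convs
    by (intro uniform_topology_initial_uniformity initial_topology_measure_subspace
        test_class_bounded_uniformly_continuous that)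
  then show ?thesis
    unfolding functors_eq_def
    by (auto simp: fcomp_def U_forget_def Unif_def measure_functor_def uniform_measure_functor_def)
qed

theorem theorem4p23:
  shows "\<forall>F \<in> {P_tau, P_hat ::
           ('a topology, 'a \<Rightarrow> 'a, 'a measure topology, 'a measure \<Rightarrow> 'a measure) fctr}.
         is_functor Tych Tych F \<and>
         (\<exists>F' :: ('a uspace, 'a \<Rightarrow> 'a, 'a measure uspace, 'a measure \<Rightarrow> 'a measure) fctr.
           is_functor Unif Unif F' \<and> functors_eq Unif (U_forget \<circ>\<^sub>F F') (F \<circ>\<^sub>F U_forget))"
proof -
  have lift: "is_functor Tych Tych (measure_functor R) \<and>
      (\<exists>F' :: ('a uspace, 'a \<Rightarrow> 'a, 'a measure uspace, 'a measure \<Rightarrow> 'a measure) fctr.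
        is_functor Unif Unif F' \<and> functors_eq Unif (U_forget \<circ>\<^sub>F F') (measure_functor R \<circ>\<^sub>F U_forget))"
    if "pushforward_stable R" for R :: "'a topology \<Rightarrow> 'a measure \<Rightarrow> bool"
    using is_functor_measure_functor[OF that] is_functor_uniform_measure_functor[OF that]
      uniform_measure_functor_lifts[of R] by blast
  have "pushforward_stable (\<lambda>(_ :: 'a topology) _. True)"
    by (simp add: pushforward_stable_def)
  moreover have "pushforward_stable (Radon_measure :: 'a topology \<Rightarrow> 'a measure \<Rightarrow> bool)"
    by (auto simp: pushforward_stable_def Tychonoff_space_def intro: distr_Radon_measure)
  ultimately show ?thesis
    using lift by (simp add: P_tau_eq_measure_functor P_hat_eq_measure_functor)
qed

end
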